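(* Let $\Omega\subset\mathbb{R}^n$, $n\ge 3$, be a bounded domain with smooth boundary, let $\lambda_1$ be the first Dirichlet eigenvalue of $-\Delta$ on $\Omega$, and let $b>\tau>0$, $|\alpha|<\lambda_1$, $2<\gamma<\frac{2(n-1)}{n-2}$. Let $(u,v)$ be a sufficiently smooth solution of $$u_{tt}-\Delta u+\alpha(v+\tau v_t)=|u|^{\gamma-2}u\ln|u|,\qquad \tau v_{ttt}+v_{tt}-\Delta v-b\Delta v_t+\alpha u=0\quad\text{in }\Omega\times(0,\infty),$$ with $u=v=0$ on $\partial\Omega\times(0,\infty)$, and set $w=v+\tau v_t$. Define $$\mathcal{E}(t):=\tfrac12\|u_t(t)\|_2^2+\tfrac12\|w_t(t)\|_2^2+\tfrac{\tau(b-\tau)}2\|\nabla v_t(t)\|_2^2+\tfrac12\|\nabla u(t)\|_2^2+\tfrac12\|\nabla w(t)\|_2^2+\alpha(u(t),w(t))-\int_\Omega F(u(t))\,dx .$$ Then for all $t\ge 0$ $$\mathcal{E}(t)+(b-\tau)\int_0^t\|\nabla v_s(s)\|_2^2\,ds=\mathcal{E}(0).$$ In particular, $\mathcal{E}'(t)=-(b-\tau)\|\nabla v_t(t)\|_2^2\le 0$.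
   Context: $\|\cdot\|_2$ and $(\cdot,\cdot)$ are the norm and inner product of $L^2(\Omega)$. $F(s)=\int_0^s|\xi|^{\gamma-2}\xi\ln|\xi|\,d\xi=\frac1\gamma|s|^\gamma\ln|s|-\frac1{\gamma^2}|s|^\gamma$, with $F(0)=0$ (and $|s|^{\gamma-2}s\ln|s|:=0$ at $s=0$). "Sufficiently smooth" means regular enough that all derivatives involved (those in the system together with $\nabla u_t$ and $\nabla w_t$, etc.) exist and are continuous on $\overline\Omega\times[0,\infty)$, so that differentiation under the integral over $\Omega$ and integration by parts in space are legitimate. *)

theory Defs
  imports "HOL-Analysis.Analysis"
begin

section \<open>Domains with smooth boundary\<close>

definition partial :: "'a::euclidean_space \<Rightarrow> ('a \<Rightarrow> real) \<Rightarrow> 'a \<Rightarrow> real" where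
  "partial i f x = deriv (\<lambda>h. f (x + h *\<^sub>R i)) 0"

definition grad :: "('a::euclidean_space \<Rightarrow> real) \<Rightarrow> 'a \<Rightarrow> 'a" where
  "grad f x = (\<Sum>i\<in>Basis. partial i f x *\<^sub>R i)"

definition laplacian :: "('a::euclidean_space \<Rightarrow> real) \<Rightarrow> 'a \<Rightarrow> real" where
  "laplacian f x = (\<Sum>i\<in>Basis. partial i (partial i f) x)"

text \<open>The class \<open>C\<^sup>k(U)\<close>, intended for open \<open>U\<close>.\<close>

fun Ck_on :: "nat \<Rightarrow> ('a::euclidean_space \<Rightarrow> real) \<Rightarrow> 'a set \<Rightarrow> bool" where
  "Ck_on 0 f U \<longleftrightarrow> continuous_on U f"
| "Ck_on (Suc k) f U \<longleftrightarrow>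
     (\<forall>x\<in>U. f differentiable (at x)) \<and> (\<forall>i\<in>Basis. Ck_on k (partial i f) U)"

text \<open>Near each boundary point, \<open>\<Omega>\<close> is the sublevel set of a smooth function without critical
  points; by the implicit function theorem \<open>\<Omega>\<close> is then locally the region on one side of a
  smooth graph.\<close>

definition smooth_boundary :: "'a::euclidean_space set \<Rightarrow> bool" where
  "smooth_boundary \<Omega> \<longleftrightarrow>
     (\<forall>p\<in>frontier \<Omega>. \<exists>U \<rho>. open U \<and> p \<in> U \<and> (\<forall>k. Ck_on k \<rho> U) \<and>
        (\<forall>x\<in>U. grad \<rho> x \<noteq> 0) \<and> \<Omega> \<inter> U = {x\<in>U. \<rho> x < 0})"

definition bounded_smooth_domain :: "'a::euclidean_space set \<Rightarrow> bool" where
  "bounded_smooth_domain \<Omega> \<longleftrightarrow>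
     open \<Omega> \<and> connected \<Omega> \<and> \<Omega> \<noteq> {} \<and> bounded \<Omega> \<and> smooth_boundary \<Omega>"

definition dirichlet_eigenvalue :: "'a::euclidean_space set \<Rightarrow> real \<Rightarrow> bool" where
  "dirichlet_eigenvalue \<Omega> \<mu> \<longleftrightarrow>
     (\<exists>\<phi>. Ck_on 2 \<phi> \<Omega> \<and> continuous_on (closure \<Omega>) \<phi> \<and> (\<exists>x\<in>\<Omega>. \<phi> x \<noteq> 0) \<and>
        (\<forall>x\<in>\<Omega>. - laplacian \<phi> x = \<mu> * \<phi> x) \<and> (\<forall>x\<in>frontier \<Omega>. \<phi> x = 0))"

definition first_dirichlet_eigenvalue :: "'a::euclidean_space set \<Rightarrow> real \<Rightarrow> bool" where
  "first_dirichlet_eigenvalue \<Omega> \<mu>\<^sub>1 \<longleftrightarrow>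
     dirichlet_eigenvalue \<Omega> \<mu>\<^sub>1 \<and> (\<forall>\<mu>. dirichlet_eigenvalue \<Omega> \<mu> \<longrightarrow> \<mu>\<^sub>1 \<le> \<mu>)"

section \<open>Inner product and norm of \<open>L\<^sup>2(\<Omega>)\<close>\<close>

text \<open>The codomain is a real inner product space so that gradients are covered as well.\<close>

definition l2_inner ::
  "'a::euclidean_space set \<Rightarrow> ('a \<Rightarrow> 'b::real_inner) \<Rightarrow> ('a \<Rightarrow> 'b) \<Rightarrow> real" where
  "l2_inner \<Omega> f g = (LINT x:\<Omega>|lborel. f x \<bullet> g x)"

definition l2_norm :: "'a::euclidean_space set \<Rightarrow> ('a \<Rightarrow> 'b::real_inner) \<Rightarrow> real" where
  "l2_norm \<Omega> f = sqrt (l2_inner \<Omega> f f)"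

section \<open>Space-time functions\<close>

text \<open>A function of \<open>(x, t)\<close> is curried. Only its values for \<open>x\<close> in \<open>closure \<Omega>\<close> and \<open>t \<ge> 0\<close>
  matter: spatial derivatives are taken at points of the open set \<open>\<Omega>\<close>, and the time derivative
  is relative to \<open>[0,\<infinity>)\<close>, that is, two-sided for \<open>t > 0\<close> and one-sided at \<open>t = 0\<close>.\<close>

definition dt :: "('a \<Rightarrow> real \<Rightarrow> real) \<Rightarrow> 'a \<Rightarrow> real \<Rightarrow> real" where
  "dt f x t = vector_derivative (f x) (at t within {0..})"

definition dx :: "'a::euclidean_space \<Rightarrow> ('a \<Rightarrow> real \<Rightarrow> real) \<Rightarrow> 'a \<Rightarrow> real \<Rightarrow> real" where
  "dx i f x t = partial i (\<lambda>y. f y t) x"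

text \<open>Continuity on \<open>closure \<Omega> \<times> [0,\<infinity>)\<close> of a derivative, which is computed only inside \<open>\<Omega>\<close>,
  means the existence of a continuous extension.\<close>

definition cont_up_to_boundary ::
  "'a::euclidean_space set \<Rightarrow> ('a \<Rightarrow> real \<Rightarrow> real) \<Rightarrow> bool" where
  "cont_up_to_boundary \<Omega> f \<longleftrightarrow>
     (\<exists>g. continuous_on (closure \<Omega> \<times> {0..}) g \<and> (\<forall>x\<in>\<Omega>. \<forall>t\<ge>0. g (x, t) = f x t))"

definition has_cont_dt :: "'a::euclidean_space set \<Rightarrow> ('a \<Rightarrow> real \<Rightarrow> real) \<Rightarrow> bool" where
  "has_cont_dt \<Omega> f \<longleftrightarrow>
     (\<forall>x\<in>\<Omega>. \<forall>t\<ge>0. f x differentiable (at t within {0..})) \<and> cont_up_to_boundary \<Omega> (dt f)"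

definition has_cont_dx :: "'a::euclidean_space set \<Rightarrow> ('a \<Rightarrow> real \<Rightarrow> real) \<Rightarrow> bool" where
  "has_cont_dx \<Omega> f \<longleftrightarrow>
     (\<forall>i\<in>Basis. (\<forall>x\<in>\<Omega>. \<forall>t\<ge>0. (\<lambda>h. f (x + h *\<^sub>R i) t) differentiable (at 0)) \<and>
        cont_up_to_boundary \<Omega> (dx i f))"

definition has_cont_dxx :: "'a::euclidean_space set \<Rightarrow> ('a \<Rightarrow> real \<Rightarrow> real) \<Rightarrow> bool" where
  "has_cont_dxx \<Omega> f \<longleftrightarrow>
     (\<forall>i\<in>Basis. \<forall>j\<in>Basis.
        (\<forall>x\<in>\<Omega>. \<forall>t\<ge>0. (\<lambda>h. dx j f (x + h *\<^sub>R i) t) differentiable (at 0)) \<and>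
        cont_up_to_boundary \<Omega> (dx i (dx j f)))"

text \<open>For \<open>u\<close>: the derivatives \<open>u\<^sub>t\<close>, \<open>u\<^sub>t\<^sub>t\<close>, \<open>\<nabla>u\<close>, \<open>\<nabla>u\<^sub>t\<close> and the second order derivatives
  in \<open>x\<close> of \<open>u\<close>.\<close>

definition sufficiently_smooth_u ::
  "'a::euclidean_space set \<Rightarrow> ('a \<Rightarrow> real \<Rightarrow> real) \<Rightarrow> bool" where
  "sufficiently_smooth_u \<Omega> u \<longleftrightarrow>
     continuous_on (closure \<Omega> \<times> {0..}) (\<lambda>(x, t). u x t) \<and>
     has_cont_dt \<Omega> u \<and> has_cont_dt \<Omega> (dt u) \<and>
     has_cont_dx \<Omega> u \<and> has_cont_dx \<Omega> (dt u) \<and>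
     has_cont_dxx \<Omega> u"

text \<open>For \<open>v\<close>: the derivatives \<open>v\<^sub>t\<close>, \<open>v\<^sub>t\<^sub>t\<close>, \<open>v\<^sub>t\<^sub>t\<^sub>t\<close>, \<open>\<nabla>v\<close>, \<open>\<nabla>v\<^sub>t\<close>, \<open>\<nabla>v\<^sub>t\<^sub>t\<close> (the last because
  \<open>\<nabla>w\<^sub>t = \<nabla>v\<^sub>t + \<tau> \<nabla>v\<^sub>t\<^sub>t\<close>) and the second order derivatives in \<open>x\<close> of \<open>v\<close> and \<open>v\<^sub>t\<close>.\<close>

definition sufficiently_smooth_v ::
  "'a::euclidean_space set \<Rightarrow> ('a \<Rightarrow> real \<Rightarrow> real) \<Rightarrow> bool" where
  "sufficiently_smooth_v \<Omega> v \<longleftrightarrow>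
     continuous_on (closure \<Omega> \<times> {0..}) (\<lambda>(x, t). v x t) \<and>
     has_cont_dt \<Omega> v \<and> has_cont_dt \<Omega> (dt v) \<and> has_cont_dt \<Omega> (dt (dt v)) \<and>
     has_cont_dx \<Omega> v \<and> has_cont_dx \<Omega> (dt v) \<and> has_cont_dx \<Omega> (dt (dt v)) \<and>
     has_cont_dxx \<Omega> v \<and> has_cont_dxx \<Omega> (dt v)"

section \<open>The system and its energy\<close>

text \<open>Since \<open>ln 0 = 0\<close> and \<open>0 powr a = 0\<close>, \<open>log_source \<gamma> 0 = 0\<close>.\<close>

definition log_source :: "real \<Rightarrow> real \<Rightarrow> real" where
  "log_source \<gamma> s = \<bar>s\<bar> powr (\<gamma> - 2) * s * ln \<bar>s\<bar>"

text \<open>The interval integral is oriented, as needed for \<open>s < 0\<close>.\<close>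

definition log_potential :: "real \<Rightarrow> real \<Rightarrow> real" where
  "log_potential \<gamma> s = (LBINT \<xi>=0..s. log_source \<gamma> \<xi>)"

definition w_of :: "real \<Rightarrow> ('a \<Rightarrow> real \<Rightarrow> real) \<Rightarrow> 'a \<Rightarrow> real \<Rightarrow> real" where
  "w_of \<tau> v x t = v x t + \<tau> * dt v x t"

definition solves_system ::
  "'a::euclidean_space set \<Rightarrow> real \<Rightarrow> real \<Rightarrow> real \<Rightarrow> real \<Rightarrow>
     ('a \<Rightarrow> real \<Rightarrow> real) \<Rightarrow> ('a \<Rightarrow> real \<Rightarrow> real) \<Rightarrow> bool" where
  "solves_system \<Omega> \<tau> b \<alpha> \<gamma> u v \<longleftrightarrow>
     (\<forall>x\<in>\<Omega>. \<forall>t>0.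
        dt (dt u) x t - laplacian (\<lambda>y. u y t) x + \<alpha> * (v x t + \<tau> * dt v x t)
          = log_source \<gamma> (u x t)) \<and>
     (\<forall>x\<in>\<Omega>. \<forall>t>0.
        \<tau> * dt (dt (dt v)) x t + dt (dt v) x t - laplacian (\<lambda>y. v y t) x
          - b * laplacian (\<lambda>y. dt v y t) x + \<alpha> * u x t = 0) \<and>
     (\<forall>x\<in>frontier \<Omega>. \<forall>t>0. u x t = 0 \<and> v x t = 0)"

definition energy ::
  "'a::euclidean_space set \<Rightarrow> real \<Rightarrow> real \<Rightarrow> real \<Rightarrow> real \<Rightarrow>
     ('a \<Rightarrow> real \<Rightarrow> real) \<Rightarrow> ('a \<Rightarrow> real \<Rightarrow> real) \<Rightarrow> real \<Rightarrow> real" where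
  "energy \<Omega> \<tau> b \<alpha> \<gamma> u v t =
     1 / 2 * (l2_norm \<Omega> (\<lambda>x. dt u x t))\<^sup>2
     + 1 / 2 * (l2_norm \<Omega> (\<lambda>x. dt (w_of \<tau> v) x t))\<^sup>2
     + \<tau> * (b - \<tau>) / 2 * (l2_norm \<Omega> (grad (\<lambda>x. dt v x t)))\<^sup>2
     + 1 / 2 * (l2_norm \<Omega> (grad (\<lambda>x. u x t)))\<^sup>2
     + 1 / 2 * (l2_norm \<Omega> (grad (\<lambda>x. w_of \<tau> v x t)))\<^sup>2
     + \<alpha> * l2_inner \<Omega> (\<lambda>x. u x t) (\<lambda>x. w_of \<tau> v x t)
     - (LINT x:\<Omega>|lborel. log_potential \<gamma> (u x t))"

end

theory Submission
  imports Defs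
begin

text \<open>Differentiate the energy under the integral sign and insert \<open>u\<^sub>t\<^sub>t\<close> and
  \<open>w\<^sub>t\<^sub>t = \<Delta>v + b\<Delta>v\<^sub>t - \<alpha>u\<close> from the system. With
  \<open>G(f,g) = \<nabla>f \<cdot> \<nabla>g + f \<Delta>g\<close> the derivative of the energy density is, pointwise,
  \<open>G(u\<^sub>t,u) + G(v\<^sub>t,v) + b G(v\<^sub>t,v\<^sub>t) + \<tau> G(v\<^sub>t\<^sub>t,v) + \<tau>b G(v\<^sub>t\<^sub>t,v\<^sub>t) - (b - \<tau>)|\<nabla>v\<^sub>t|\<^sup>2\<close>,
  and each \<open>G\<close> integrates to zero by Green's identity, because \<open>u\<^sub>t\<close>, \<open>v\<^sub>t\<close> and \<open>v\<^sub>t\<^sub>t\<close> inherit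
  the boundary condition.\<close>

section \<open>Integration by parts on open sets\<close>

text \<open>Derivatives are known only inside \<open>\<Omega>\<close>, with continuous extensions to
  \<open>closure \<Omega> \<times> {0..}\<close>, and this shapes three steps. Green's identity is
  obtained without surface integrals: \<open>f * dx i g\<close> vanishes on the frontier, so its
  \<open>i\<close>-th partial derivative has integral zero along every line parallel to
  \<open>i\<close>. The boundary values of \<open>u\<^sub>t\<close>, \<open>v\<^sub>t\<close>,
  \<open>v\<^sub>t\<^sub>t\<close> are those of the extensions, so their vanishing has to be derived
  by a limit from inside. Smoothness supplies \<open>\<nabla>u\<^sub>t\<close> as the gradient of
  \<open>u\<^sub>t\<close>, not as the time derivative of \<open>\<nabla>u\<close>; that the two
  agree is needed before the gradient terms of the energy can be differentiated. The coefficient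
  \<open>\<tau>(b - \<tau>)\<close> comes from \<open>\<nabla>w \<cdot> \<nabla>w\<^sub>t\<close>,
  which contains \<open>\<tau>\<^sup>2 \<nabla>v\<^sub>t \<cdot> \<nabla>v\<^sub>t\<^sub>t\<close>
  and \<open>\<tau> |\<nabla>v\<^sub>t|\<^sup>2\<close>. The former raises
  \<open>\<tau>(b - \<tau>)\<close> to the \<open>\<tau>b\<close> that
  \<open>G(v\<^sub>t\<^sub>t,v\<^sub>t)\<close> requires; the latter falls short of the
  \<open>b |\<nabla>v\<^sub>t|\<^sup>2\<close> in \<open>b G(v\<^sub>t,v\<^sub>t)\<close> by exactly
  the dissipation.\<close>

lemma set_integral_deriv_open_real:
  fixes f f' :: "real \<Rightarrow> real"
  assumes "open S" "bounded S"
    and contf: "continuous_on (closure S) f"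
    and int: "set_integrable lborel S f'"
    and zero: "\<And>x. x \<in> frontier S \<Longrightarrow> f x = 0"
    and deriv: "\<And>x. x \<in> S \<Longrightarrow> (f has_real_derivative f' x) (at x)"
  shows "(LINT x:S|lborel. f' x) = 0"
proof -
  have opn: "open C" if "C \<in> components S" for C
    using \<open>open S\<close> open_components that by blast
  have cnt: "countable (components S)"
    by (rule countable_disjoint_open_subsets)
      (use opn pairwise_disjoint_components[of S] in \<open>auto simp: pairwise_def disjnt_def\<close>)
  \<comment> \<open>Each component is a bounded open interval \<open>(a, b)\<close> with
    \<open>a\<close> and \<open>b\<close> in \<open>frontier S\<close>, where \<open>f\<close>
    vanishes, so the fundamental theorem of calculus gives \<open>f b - f a = 0\<close>. Its
    interior version fits, since \<open>f\<close> is differentiable in \<open>S\<close> but only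
    continuous on the closure.\<close>
  have zeroC: "(LINT x:C|lborel. f' x) = 0" if C: "C \<in> components S" for C
  proof -
    have sub: "C \<subseteq> S" using C in_components_subset by auto
    have ne: "C \<noteq> {}" using C in_components_nonempty by auto
    have con: "connected C" using C in_components_connected by auto
    have bd: "bounded C" using sub \<open>bounded S\<close> bounded_subset by auto
    define a b where "a = Inf C" and "b = Sup C"
    have bdd: "bdd_below C" "bdd_above C"
      using bd bounded_imp_bdd_below bounded_imp_bdd_above by auto
    have "a \<notin> C"
    proof
      assume "a \<in> C"
      then obtain e where e: "e > 0" "ball a e \<subseteq> C" using opn[OF C] open_contains_ball by blast
      then have "a - e/2 \<in> C" by (auto simp: dist_real_def)
      then have "a \<le> a - e/2" unfolding a_def using cInf_lower bdd(1) by blast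
      then show False using e by simp
    qed
    have "b \<notin> C"
    proof
      assume "b \<in> C"
      then obtain e where e: "e > 0" "ball b e \<subseteq> C" using opn[OF C] open_contains_ball by blast
      then have "b + e/2 \<in> C" by (auto simp: dist_real_def)
      then have "b + e/2 \<le> b" unfolding b_def using cSup_upper bdd(2) by blast
      then show False using e by simp
    qed
    have Ceq: "C = {a<..<b}"
    proof
      show "C \<subseteq> {a<..<b}"
      proof
        fix x assume x: "x \<in> C"
        then have "a \<le> x" "x \<le> b"
          using cInf_lower cSup_upper bdd by (auto simp: a_def b_def)
        then show "x \<in> {a<..<b}" using x \<open>a \<notin> C\<close> \<open>b \<notin> C\<close> by (auto simp: less_le)
      qed
    next
      show "{a<..<b} \<subseteq> C"
      proof
        fix x assume x: "x \<in> {a<..<b}"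
        obtain y z where "y \<in> C" "y < x" "z \<in> C" "x < z"
          using x cInf_less_iff[OF ne bdd(1), of x] less_cSup_iff[OF ne bdd(2), of x]
          by (auto simp: a_def b_def)
        then show "x \<in> C"
          using con connected_contains_Icc[of C y z] by auto
      qed
    qed
    have ab: "a < b" using ne Ceq by auto
    have cl: "{a..b} \<subseteq> closure S"
      using closure_mono[OF sub] ab unfolding Ceq by simp
    have endp: "c \<in> frontier S" if c: "c \<in> {a, b}" for c
    proof -
      have "c \<in> closure S" using cl c ab by auto
      \<comment> \<open>Maximality of components: an endpoint lying in \<open>S\<close> could be
        adjoined to \<open>C\<close>, and the result, caught between \<open>C\<close> and its
        closure, would still be connected.\<close>
      moreover have "c \<notin> S"
      proof
        assume "c \<in> S"
        then have "insert c C \<subseteq> S" using sub by auto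
        moreover have "connected (insert c C)"
        proof (rule connected_intermediate_closure[OF con])
          show "insert c C \<subseteq> closure C"
            using c ab closure_subset[of C] by (auto simp: Ceq)
        qed auto
        ultimately have "insert c C \<subseteq> C"
          using C unfolding in_components_maximal by (metis insert_not_empty order_refl subset_insertI)
        then show False using c \<open>a \<notin> C\<close> \<open>b \<notin> C\<close> by auto
      qed
      ultimately show ?thesis using \<open>open S\<close> by (simp add: frontier_def interior_open)
    qed
    have "(f' has_integral (f b - f a)) {a..b}"
    proof (rule fundamental_theorem_of_calculus_interior)
      show "continuous_on {a..b} f" using contf cl continuous_on_subset by blast
      show "(f has_vector_derivative f' x) (at x)" if "x \<in> {a<..<b}" for x
        using deriv[of x] sub that Ceq has_real_derivative_iff_has_vector_derivative by blast
    qed (use ab in auto)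
    moreover have "(LINT x:C|lborel. f' x) = integral C f'"
      by (rule set_borel_integral_eq_integral(2), rule set_integrable_subset[OF int])
        (use sub Ceq in auto)
    ultimately show ?thesis
      using integral_open_interval_real[of a b f'] endp[THEN zero] by (simp add: Ceq integral_unique)
  qed
  \<comment> \<open>Numbering the components by natural numbers, with the empty set at indices that
    are not taken, makes countable additivity apply to finitely and infinitely many components
    alike.\<close>
  define A where "A n = \<Union>{C \<in> components S. to_nat_on (components S) C = n}" for n
  have A_cases: "A n = {} \<or> A n \<in> components S" for n
  proof (cases "\<exists>C\<in>components S. to_nat_on (components S) C = n")
    case True
    then obtain C where C: "C \<in> components S" "to_nat_on (components S) C = n" by auto
    then have "{C' \<in> components S. to_nat_on (components S) C' = n} = {C}"
      using inj_on_to_nat_on[OF cnt] by (auto simp: inj_on_def)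
    then show ?thesis using C by (simp add: A_def)
  next
    case False
    then show ?thesis by (auto simp: A_def)
  qed
  have Un: "(\<Union>n. A n) = S"
    unfolding A_def using Union_components[of S] by blast
  have disj: "A m \<inter> A n = {}" if "m \<noteq> n" for m n
  proof -
    have "C \<inter> D = {}" if "C \<in> components S" "D \<in> components S" "C \<noteq> D" for C D
      using that components_eq by blast
    then show ?thesis using \<open>m \<noteq> n\<close> unfolding A_def by blast
  qed
  have "(LINT x:(\<Union>n. A n)|lborel. f' x) = (\<Sum>n. (LINT x:(A n)|lborel. f' x))"
  proof (rule lebesgue_integral_countable_add)
    show "A n \<in> sets lborel" for n using A_cases[of n] opn by auto
  qed (use disj int Un in auto)
  also have "\<dots> = (\<Sum>n::nat. 0)"
  proof -
    have "(LINT x:(A n)|lborel. f' x) = 0" for n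
      using A_cases[of n] zeroC by (auto simp: set_lebesgue_integral_def)
    then show ?thesis by simp
  qed
  finally show ?thesis using Un by simp
qed

lemma set_integrable_closure_continuous:
  fixes f :: "'a::euclidean_space \<Rightarrow> real"
  assumes "open S" "bounded S" "continuous_on (closure S) f"
  shows "set_integrable lborel S f"
proof -
  have "set_integrable lborel (closure S) f"
    unfolding set_integrable_def
    using borel_integrable_compact[of "closure S" f] assms by (simp add: compact_closure)
  then show ?thesis
    by (rule set_integrable_subset) (use assms closure_subset in \<open>auto simp: subset_iff\<close>)
qed

text \<open>Fubini in the direction \<open>i\<close> reduces the claim to the open subset of the real line cut out
  of \<open>\<Omega>\<close> by each line parallel to \<open>i\<close>.\<close>

lemma set_integral_partial_eq_0:
  fixes \<Omega> :: "'a::euclidean_space set" and f f' :: "'a \<Rightarrow> real"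
  assumes "open \<Omega>" "bounded \<Omega>" and i: "i \<in> Basis"
    and contf: "continuous_on (closure \<Omega>) f"
    and contf': "continuous_on (closure \<Omega>) f'"
    and zero: "\<And>x. x \<in> frontier \<Omega> \<Longrightarrow> f x = 0"
    and deriv: "\<And>x. x \<in> \<Omega> \<Longrightarrow> ((\<lambda>h. f (x + h *\<^sub>R i)) has_real_derivative f' x) (at 0)"
  shows "(LINT x:\<Omega>|lborel. f' x) = 0"
proof -
  define g where "g = (\<lambda>x. indicator \<Omega> x *\<^sub>R f' x)"
  \<comment> \<open>Lebesgue measure is the image under \<open>\<Phi>\<close> of the product
    \<open>P\<close> of one-dimensional Lebesgue measures over the basis. In this form a single
    coordinate can be split off.\<close>
  define \<Phi> where "\<Phi> = (\<lambda>z. \<Sum>b\<in>Basis. z b *\<^sub>R (b::'a))"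
  define P where "P = (\<Pi>\<^sub>M b\<in>(Basis::'a set). (lborel::real measure))"
  interpret product_sigma_finite "\<lambda>b::'a. lborel::real measure"
    by standard
  have line: "(LINT s|lborel. g (y + s *\<^sub>R i)) = 0" for y
  proof -
    \<comment> \<open>The line may meet \<open>\<Omega>\<close> in infinitely many intervals, which
      is why the one-dimensional lemma admits any bounded open set. \<open>closure S\<close> is
      carried into \<open>closure \<Omega>\<close> and \<open>frontier S\<close> into
      \<open>frontier \<Omega>\<close>, so the boundary condition passes to the slice.\<close>
    define S where "S = (\<lambda>s. y + s *\<^sub>R i) -` \<Omega>"
    have cont: "continuous_on A (\<lambda>s. y + s *\<^sub>R i)" for A by (intro continuous_intros)
    have "open S" unfolding S_def
      using \<open>open \<Omega>\<close> cont[of UNIV] by (simp add: continuous_on_open_vimage open_vimage)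
    obtain K where K: "\<And>x. x \<in> \<Omega> \<Longrightarrow> norm x \<le> K" using \<open>bounded \<Omega>\<close> by (auto simp: bounded_iff)
    have "bounded S" unfolding bounded_iff
    proof (intro exI ballI)
      fix s assume "s \<in> S"
      then have "norm (y + s *\<^sub>R i) \<le> K" using K by (auto simp: S_def)
      moreover have "norm (s *\<^sub>R i) \<le> norm (y + s *\<^sub>R i) + norm y"
        using norm_triangle_ineq4[of "y + s *\<^sub>R i" y] by simp
      ultimately show "norm s \<le> K + norm y" using i by simp
    qed
    have cl: "y + s *\<^sub>R i \<in> closure \<Omega>" if "s \<in> closure S" for s
    proof -
      have "(\<lambda>s. y + s *\<^sub>R i) ` closure S \<subseteq> closure ((\<lambda>s. y + s *\<^sub>R i) ` S)"
        by (rule image_closure_subset) (auto intro: cont closure_subset[THEN subsetD])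
      also have "\<dots> \<subseteq> closure \<Omega>" by (rule closure_mono) (auto simp: S_def)
      finally show ?thesis using that by auto
    qed
    have "(LINT s:S|lborel. f' (y + s *\<^sub>R i)) = 0"
    proof (rule set_integral_deriv_open_real[where f = "\<lambda>s. f (y + s *\<^sub>R i)"])
      show "continuous_on (closure S) (\<lambda>s. f (y + s *\<^sub>R i))"
        by (rule continuous_on_compose2[OF contf cont]) (use cl in auto)
      have "continuous_on (closure S) (\<lambda>s. f' (y + s *\<^sub>R i))"
        by (rule continuous_on_compose2[OF contf' cont]) (use cl in auto)
      then show "set_integrable lborel S (\<lambda>s. f' (y + s *\<^sub>R i))"
        using \<open>open S\<close> \<open>bounded S\<close> set_integrable_closure_continuous by blast
      show "f (y + s *\<^sub>R i) = 0" if "s \<in> frontier S" for s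
      proof (rule zero)
        have "s \<in> closure S" "s \<notin> S" using that \<open>open S\<close> by (auto simp: frontier_def interior_open)
        then show "y + s *\<^sub>R i \<in> frontier \<Omega>"
          using cl[of s] \<open>open \<Omega>\<close> by (auto simp: frontier_def interior_open S_def)
      qed
      show "((\<lambda>s. f (y + s *\<^sub>R i)) has_real_derivative f' (y + s *\<^sub>R i)) (at s)" if "s \<in> S" for s
      proof -
        have "((\<lambda>h. f (y + (h + s) *\<^sub>R i)) has_real_derivative f' (y + s *\<^sub>R i)) (at 0)"
          using deriv[of "y + s *\<^sub>R i"] that by (simp add: S_def algebra_simps)
        then show ?thesis
          using DERIV_shift[of "\<lambda>s. f (y + s *\<^sub>R i)" "f' (y + s *\<^sub>R i)" 0 s] by simp
      qed
    qed (use \<open>open S\<close> \<open>bounded S\<close> in auto)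
    moreover have "indicator S s *\<^sub>R f' (y + s *\<^sub>R i) = g (y + s *\<^sub>R i)" for s
      by (simp add: g_def S_def indicator_def)
    ultimately show ?thesis by (simp add: set_lebesgue_integral_def)
  qed
  have gint: "integrable lborel g"
    using set_integrable_closure_continuous[OF assms(1,2) contf']
    by (simp add: g_def set_integrable_def)
  have gm[measurable]: "g \<in> borel_measurable borel"
    using gint borel_measurable_integrable by fastforce
  have \<Phi>m[measurable]: "\<Phi> \<in> measurable P borel"
    unfolding \<Phi>_def P_def by measurable
  have lb: "(lborel :: 'a measure) = distr P borel \<Phi>"
    unfolding P_def \<Phi>_def by (rule lborel_eq)
  have gP: "integrable P (\<lambda>z. g (\<Phi> z))"
    using gint unfolding lb by (simp add: integrable_distr_eq)
  have "integral\<^sup>L lborel g = (LINT z|P. g (\<Phi> z))"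
    unfolding lb by (simp add: integral_distr)
  also have "\<dots> = (LINT z|Pi\<^sub>M (Basis - {i}) (\<lambda>_. lborel). LINT s|lborel. g (\<Phi> (z(i := s))))"
    using product_integral_insert[of "Basis - {i}" i "\<lambda>z. g (\<Phi> z)"] gP i
    by (simp add: P_def insert_absorb)
  also have "(\<lambda>z. LINT s|lborel. g (\<Phi> (z(i := s)))) = (\<lambda>z. 0)"
  proof
    fix z :: "'a \<Rightarrow> real"
    have "\<Phi> (z(i := s)) = (\<Sum>b\<in>Basis - {i}. z b *\<^sub>R b) + s *\<^sub>R i" for s
      unfolding \<Phi>_def using i
      by (subst sum.remove[of _ i]) (auto simp: add.commute intro!: sum.cong)
    then show "(LINT s|lborel. g (\<Phi> (z(i := s)))) = 0" using line by simp
  qed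
  finally show ?thesis by (simp add: g_def set_lebesgue_integral_def)
qed

section \<open>Functions continuous up to the boundary\<close>

lemma cont_up_const: "cont_up_to_boundary \<Omega> (\<lambda>x t. c)"
  unfolding cont_up_to_boundary_def by (intro exI[of _ "\<lambda>_. c"]) auto

lemma cont_up_add:
  assumes "cont_up_to_boundary \<Omega> f" "cont_up_to_boundary \<Omega> g"
  shows "cont_up_to_boundary \<Omega> (\<lambda>x t. f x t + g x t)"
proof -
  obtain F G where "continuous_on (closure \<Omega> \<times> {0..}) F" "\<forall>x\<in>\<Omega>. \<forall>t\<ge>0. F (x, t) = f x t"
    "continuous_on (closure \<Omega> \<times> {0..}) G" "\<forall>x\<in>\<Omega>. \<forall>t\<ge>0. G (x, t) = g x t"
    using assms unfolding cont_up_to_boundary_def by auto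
  then show ?thesis unfolding cont_up_to_boundary_def
    by (intro exI[of _ "\<lambda>z. F z + G z"]) (auto intro!: continuous_intros)
qed

lemma cont_up_mult:
  assumes "cont_up_to_boundary \<Omega> f" "cont_up_to_boundary \<Omega> g"
  shows "cont_up_to_boundary \<Omega> (\<lambda>x t. f x t * g x t)"
proof -
  obtain F G where "continuous_on (closure \<Omega> \<times> {0..}) F" "\<forall>x\<in>\<Omega>. \<forall>t\<ge>0. F (x, t) = f x t"
    "continuous_on (closure \<Omega> \<times> {0..}) G" "\<forall>x\<in>\<Omega>. \<forall>t\<ge>0. G (x, t) = g x t"
    using assms unfolding cont_up_to_boundary_def by auto
  then show ?thesis unfolding cont_up_to_boundary_def
    by (intro exI[of _ "\<lambda>z. F z * G z"]) (auto intro!: continuous_intros)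
qed

lemma cont_up_compose:
  fixes h :: "real \<Rightarrow> real"
  assumes "continuous_on UNIV h" "cont_up_to_boundary \<Omega> f"
  shows "cont_up_to_boundary \<Omega> (\<lambda>x t. h (f x t))"
proof -
  obtain F where "continuous_on (closure \<Omega> \<times> {0..}) F" "\<forall>x\<in>\<Omega>. \<forall>t\<ge>0. F (x, t) = f x t"
    using assms unfolding cont_up_to_boundary_def by auto
  then show ?thesis unfolding cont_up_to_boundary_def
    by (intro exI[of _ "\<lambda>z. h (F z)"]) (auto intro!: continuous_on_compose2[OF assms(1)])
qed

lemma cont_up_diff:
  assumes "cont_up_to_boundary \<Omega> f" "cont_up_to_boundary \<Omega> g"
  shows "cont_up_to_boundary \<Omega> (\<lambda>x t. f x t - g x t)"
  using cont_up_add[OF assms(1) cont_up_mult[OF cont_up_const[of _ "-1"] assms(2)]] by simp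

lemma cont_up_power:
  assumes "cont_up_to_boundary \<Omega> f"
  shows "cont_up_to_boundary \<Omega> (\<lambda>x t. (f x t) ^ n)"
  by (rule cont_up_compose[of "\<lambda>s. s ^ n", OF _ assms]) (intro continuous_intros)

lemma cont_up_sum:
  assumes "\<And>i. i \<in> I \<Longrightarrow> cont_up_to_boundary \<Omega> (f i)"
  shows "cont_up_to_boundary \<Omega> (\<lambda>x t. \<Sum>i\<in>I. f i x t)"
  using assms
proof (induction I rule: infinite_finite_induct)
  case (insert i I)
  then show ?case using cont_up_add[of \<Omega> "f i" "\<lambda>x t. \<Sum>i\<in>I. f i x t"] by auto
qed (simp_all add: cont_up_const)

lemmas cont_up_intros =
  cont_up_const cont_up_add cont_up_diff cont_up_mult cont_up_power cont_up_sum

lemma cont_up_continuous_on: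
  assumes "cont_up_to_boundary \<Omega> f"
  shows "continuous_on (\<Omega> \<times> {0..}) (\<lambda>(x, t). f x t)"
proof -
  obtain F where F: "continuous_on (closure \<Omega> \<times> {0..}) F" "\<forall>x\<in>\<Omega>. \<forall>t\<ge>0. F (x, t) = f x t"
    using assms unfolding cont_up_to_boundary_def by auto
  have "continuous_on (\<Omega> \<times> {0..}) F"
    using F(1) closure_subset by (rule continuous_on_subset[OF _ Sigma_mono]) auto
  then show ?thesis by (rule continuous_on_eq) (use F in auto)
qed

lemma cont_up_continuous_on_time:
  assumes "cont_up_to_boundary \<Omega> f" "x \<in> \<Omega>"
  shows "continuous_on {0..} (f x)"
proof -
  have "continuous_on {0..} (\<lambda>t. (x, t))" by (intro continuous_intros)
  from continuous_on_compose2[OF cont_up_continuous_on[OF assms(1)] this]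
  show ?thesis using assms(2) by auto
qed

lemma cont_up_set_integrable:
  fixes \<Omega> :: "'a::euclidean_space set"
  assumes "open \<Omega>" "bounded \<Omega>" "cont_up_to_boundary \<Omega> f" "0 \<le> t"
  shows "set_integrable lborel \<Omega> (\<lambda>x. f x t)"
proof -
  obtain F where F: "continuous_on (closure \<Omega> \<times> {0..}) F" "\<forall>x\<in>\<Omega>. \<forall>t\<ge>0. F (x, t) = f x t"
    using assms unfolding cont_up_to_boundary_def by auto
  have "continuous_on (closure \<Omega>) (\<lambda>x. F (x, t))"
    by (rule continuous_on_compose2[OF F(1)]) (use assms in \<open>auto intro!: continuous_intros\<close>)
  then have "set_integrable lborel \<Omega> (\<lambda>x. F (x, t))"
    by (rule set_integrable_closure_continuous[OF assms(1,2)])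
  then show ?thesis
    using F(2) assms(4) by (subst set_integrable_cong[of lborel lborel \<Omega> \<Omega>, OF refl refl]) auto
qed

text \<open>The extension is continuous on the compact set
  \<open>closure \<Omega> \<times> {0..T}\<close>. The bound is uniform in \<open>x\<close> and thus
  serves as the dominating constant for differentiation under the integral.\<close>

lemma cont_up_bounded:
  fixes \<Omega> :: "'a::euclidean_space set"
  assumes "bounded \<Omega>" "cont_up_to_boundary \<Omega> f"
  obtains B where "\<And>x t. x \<in> \<Omega> \<Longrightarrow> 0 \<le> t \<Longrightarrow> t \<le> T \<Longrightarrow> \<bar>f x t\<bar> \<le> B"
proof -
  obtain F where F: "continuous_on (closure \<Omega> \<times> {0..}) F" "\<forall>x\<in>\<Omega>. \<forall>t\<ge>0. F (x, t) = f x t"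
    using assms unfolding cont_up_to_boundary_def by auto
  have "compact (F ` (closure \<Omega> \<times> {0..T}))"
    by (intro compact_continuous_image continuous_on_subset[OF F(1)] compact_Times)
      (use assms in \<open>auto simp: compact_closure\<close>)
  then have "bounded (F ` (closure \<Omega> \<times> {0..T}))"
    by (rule compact_imp_bounded)
  then obtain B where B: "\<forall>y\<in>F ` (closure \<Omega> \<times> {0..T}). norm y \<le> B"
    unfolding bounded_iff by (elim exE)
  then have "\<bar>f x t\<bar> \<le> B" if "x \<in> \<Omega>" "0 \<le> t" "t \<le> T" for x t
  proof -
    have "F (x, t) \<in> F ` (closure \<Omega> \<times> {0..T})"
      using that closure_subset by (intro imageI) auto
    then show ?thesis using B F(2) that by (metis real_norm_def)
  qed
  then show ?thesis by (rule that)
qed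

text \<open>Dominated convergence for the difference quotients along a sequence of times: the mean
  value inequality bounds them by a constant, which is integrable over the bounded set
  \<open>\<Omega>\<close>. Derivatives relative to \<open>{0..}\<close> include the one-sided case
  \<open>t = 0\<close>.\<close>

lemma has_real_derivative_set_integral:
  fixes \<Omega> :: "'a::euclidean_space set"
  assumes \<Omega>: "open \<Omega>" "bounded \<Omega>"
    and f: "cont_up_to_boundary \<Omega> f" and f': "cont_up_to_boundary \<Omega> f'"
    and deriv: "\<And>x t. x \<in> \<Omega> \<Longrightarrow> 0 \<le> t \<Longrightarrow> (f x has_real_derivative f' x t) (at t within {0..})"
    and t: "0 \<le> t"
  shows "((\<lambda>t. LINT x:\<Omega>|lborel. f x t) has_real_derivative (LINT x:\<Omega>|lborel. f' x t)) (at t within {0..})"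
  unfolding has_field_derivative_iff tendsto_at_iff_sequentially
proof (intro allI impI)
  fix X :: "nat \<Rightarrow> real"
  assume X: "\<forall>n. X n \<in> {0..} - {t}" "X \<longlonglongrightarrow> t"
  obtain K where K: "\<And>n. norm (X n) \<le> K"
    using X(2) by (meson Bseq_def convergentI convergent_imp_Bseq)
  \<comment> \<open>A finite horizon containing \<open>t\<close> and the whole convergent sequence
    \<open>X\<close>; the bound on \<open>f'\<close> is available only on bounded time
    intervals.\<close>
  define T where "T = max K t"
  have XT: "X n \<in> {0..T}" for n using X(1) K[of n] by (auto simp: T_def max_def)
  have tT: "t \<in> {0..T}" using t by (auto simp: T_def)
  obtain B where B: "\<And>x s. x \<in> \<Omega> \<Longrightarrow> 0 \<le> s \<Longrightarrow> s \<le> T \<Longrightarrow> \<bar>f' x s\<bar> \<le> B"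
    using cont_up_bounded[OF \<Omega>(2) f'] by blast
  define q where "q n x = (f x (X n) - f x t) / (X n - t)" for n x
  have qint: "set_integrable lborel \<Omega> (q n)" for n
    unfolding q_def using X(1) t
    by (intro set_integrable_divide set_integral_diff(1) cont_up_set_integrable[OF \<Omega> f]) auto
  have fint: "set_integrable lborel \<Omega> (\<lambda>x. f' x t)"
    by (rule cont_up_set_integrable[OF \<Omega> f' t])
  have q_bound: "norm (q n x) \<le> B" if x: "x \<in> \<Omega>" for n x
  proof -
    have "norm (f x (X n) - f x t) \<le> B * norm (X n - t)"
    proof (rule field_differentiable_bound[of "{0..T}" "f x" "f' x"])
      show "(f x has_real_derivative f' x s) (at s within {0..T})" if "s \<in> {0..T}" for s
        by (rule DERIV_subset[OF deriv]) (use that x in auto)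
    qed (use B x XT tT in auto)
    then show ?thesis using X(1)[rule_format, of n] by (simp add: q_def divide_le_eq)
  qed
  have "(\<lambda>n. LINT x|lborel. indicator \<Omega> x *\<^sub>R q n x) \<longlonglongrightarrow> (LINT x|lborel. indicator \<Omega> x *\<^sub>R f' x t)"
  proof (rule integral_dominated_convergence[where w = "\<lambda>x. indicator \<Omega> x *\<^sub>R B"])
    show "integrable lborel (\<lambda>x. indicator \<Omega> x *\<^sub>R B)"
      using cont_up_set_integrable[OF \<Omega> cont_up_const[of _ B] t] by (simp add: set_integrable_def)
    show "AE x in lborel. (\<lambda>n. indicator \<Omega> x *\<^sub>R q n x) \<longlonglongrightarrow> indicator \<Omega> x *\<^sub>R f' x t"
    proof (intro AE_I2)
      fix x
      show "(\<lambda>n. indicator \<Omega> x *\<^sub>R q n x) \<longlonglongrightarrow> indicator \<Omega> x *\<^sub>R f' x t"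
      proof (cases "x \<in> \<Omega>")
        case True
        show ?thesis
          using deriv[OF True t] X True
          unfolding has_field_derivative_iff tendsto_at_iff_sequentially
          by (auto simp: q_def o_def)
      qed auto
    qed
    show "AE x in lborel. norm (indicator \<Omega> x *\<^sub>R q n x) \<le> indicator \<Omega> x *\<^sub>R B" for n
      using q_bound by (intro AE_I2) (auto simp: indicator_def)
  qed (use qint fint in \<open>auto simp: set_integrable_def dest: borel_measurable_integrable\<close>)
  moreover have "((\<lambda>s. ((LINT x:\<Omega>|lborel. f x s) - (LINT x:\<Omega>|lborel. f x t)) / (s - t)) \<circ> X) n
      = (LINT x|lborel. indicator \<Omega> x *\<^sub>R q n x)" for n
    using X(1)[rule_format, of n] t set_integral_diff(2)[OF cont_up_set_integrable[OF \<Omega> f] cont_up_set_integrable[OF \<Omega> f], of "X n" t]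
    by (simp only: q_def set_integral_divide_zero o_def flip: set_lebesgue_integral_def) auto
  ultimately show "((\<lambda>s. ((LINT x:\<Omega>|lborel. f x s) - (LINT x:\<Omega>|lborel. f x t)) / (s - t)) \<circ> X)
      \<longlonglongrightarrow> (LINT x:\<Omega>|lborel. f' x t)"
    by (simp add: set_lebesgue_integral_def o_def)
qed

section \<open>Time and space derivatives\<close>

text \<open>The fundamental theorem yields derivatives relative to compact intervals. Ending the
  interval at \<open>t+1\<close> keeps \<open>t\<close> away from its right end, so nothing changes
  near \<open>t\<close> when passing to the half-line.\<close>

lemma at_within_Icc_eq_Ici:
  fixes t :: real
  assumes "0 \<le> t"
  shows "at t within {0..t+1} = at t within {0..}"
  by (rule at_within_nhd[of _ "{..<t+1}"]) (use assms in auto)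

text \<open>Every \<open>t \<ge> 0\<close> is a limit point of the half-line from the right, so the
  limit of the difference quotients is unique even at \<open>t = 0\<close>.\<close>

lemma has_real_derivative_unique_Ici:
  assumes "(f has_real_derivative D) (at t within {0..})" "(f has_real_derivative E) (at t within {0..})"
    and "0 \<le> t"
  shows "D = E"
proof -
  have "t islimpt {t..t+1}" by (simp add: islimpt_Icc)
  then have "t islimpt {0..}" by (rule islimpt_subset) (use assms in auto)
  then have "at t within {0..} \<noteq> bot" by (simp add: trivial_limit_within)
  then show ?thesis
    using assms unfolding has_field_derivative_iff by (blast intro: tendsto_unique)
qed

lemma has_cont_dt_DERIV:
  assumes "has_cont_dt \<Omega> f" "x \<in> \<Omega>" "0 \<le> t"
  shows "(f x has_real_derivative dt f x t) (at t within {0..})"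
  using assms unfolding has_cont_dt_def dt_def has_real_derivative_iff_has_vector_derivative
  by (simp flip: vector_derivative_works)

lemma has_cont_dx_DERIV:
  assumes "has_cont_dx \<Omega> f" "x \<in> \<Omega>" "0 \<le> t" "i \<in> Basis"
  shows "((\<lambda>h. f (x + h *\<^sub>R i) t) has_real_derivative dx i f x t) (at 0)"
  using assms unfolding has_cont_dx_def dx_def partial_def
  by (simp add: DERIV_deriv_iff_real_differentiable)

lemma has_cont_dxx_DERIV:
  assumes "has_cont_dxx \<Omega> f" "x \<in> \<Omega>" "0 \<le> t" "i \<in> Basis" "j \<in> Basis"
  shows "((\<lambda>h. dx j f (x + h *\<^sub>R i) t) has_real_derivative dx i (dx j f) x t) (at 0)"
  using assms unfolding has_cont_dxx_def
  by (simp add: DERIV_deriv_iff_real_differentiable dx_def[of i] partial_def)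

lemma dt_integral_eq:
  assumes "has_cont_dt \<Omega> f" "x \<in> \<Omega>" "0 \<le> r" "r \<le> t"
  shows "(dt f x has_integral (f x t - f x r)) {r..t}"
proof (rule fundamental_theorem_of_calculus)
  show "(f x has_vector_derivative dt f x s) (at s within {r..t})" if "s \<in> {r..t}" for s
    using DERIV_subset[OF has_cont_dt_DERIV[OF assms(1,2)], of s "{r..t}"] that assms
    by (auto simp: has_real_derivative_iff_has_vector_derivative)
qed (use assms in auto)

text \<open>Clairaut's theorem in a form that does not presuppose the existence of the mixed
  derivative on the left: differentiate \<open>f(x,t) = f(x,0) + \<integral>\<^sub>0\<^sup>t \<partial>\<^sub>tf(x,s) ds\<close> in \<open>x\<close>.\<close>

lemma dx_has_derivative_dt:
  fixes \<Omega> :: "'a::euclidean_space set"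
  assumes "open \<Omega>" and ft: "has_cont_dt \<Omega> f" and fx: "has_cont_dx \<Omega> f"
    and ftx: "has_cont_dx \<Omega> (dt f)" and x: "x \<in> \<Omega>" and t: "0 \<le> t" and i: "i \<in> Basis"
  shows "(dx i f x has_real_derivative dx i (dt f) x t) (at t within {0..})"
proof -
  obtain e where e: "e > 0" "ball x e \<subseteq> \<Omega>" using \<open>open \<Omega>\<close> x open_contains_ball by blast
  have in\<Omega>: "x + h *\<^sub>R i \<in> \<Omega>" if "h \<in> ball 0 e" for h :: real
    using that e i by (auto simp: dist_norm subset_iff)
  define p where "p = dx i (dt f)"
  have p: "cont_up_to_boundary \<Omega> p" using ftx i by (simp add: has_cont_dx_def p_def)
  have ftc: "cont_up_to_boundary \<Omega> (dt f)" using ft by (simp add: has_cont_dt_def)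
  \<comment> \<open>Both sides are the derivative at \<open>h = 0\<close> of
    \<open>f (x + h *\<^sub>R i) s\<close>, the right one by Leibniz' rule on a ball that stays
    inside \<open>\<Omega>\<close>. Once \<open>dx i f x s\<close> is a constant plus a time
    integral of the continuous function \<open>p x\<close>, the fundamental theorem gives its time
    derivative.\<close>
  have inc: "dx i f x s = dx i f x 0 + integral {0..s} (p x)" if s: "0 \<le> s" for s
  proof -
    have "((\<lambda>h. integral (cbox 0 s) (dt f (x + h *\<^sub>R i))) has_real_derivative
        integral (cbox 0 s) (p (x + 0 *\<^sub>R i))) (at 0 within ball 0 e)"
    proof (rule leibniz_rule_field_derivative)
      show "((\<lambda>h. dt f (x + h *\<^sub>R i) r) has_real_derivative p (x + h *\<^sub>R i) r) (at h within ball 0 e)"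
        if "h \<in> ball 0 e" "r \<in> cbox 0 s" for h r
      proof -
        have "((\<lambda>k. dt f (x + (k + h) *\<^sub>R i) r) has_real_derivative p (x + h *\<^sub>R i) r) (at 0)"
          using has_cont_dx_DERIV[OF ftx in\<Omega>[OF that(1)] _ i, of r] that(2)
          by (simp add: algebra_simps p_def)
        then show ?thesis
          using DERIV_shift[of "\<lambda>k. dt f (x + k *\<^sub>R i) r" _ 0 h]
          by (auto intro: has_field_derivative_at_within)
      qed
      show "dt f (x + h *\<^sub>R i) integrable_on cbox 0 s" if "h \<in> ball 0 e" for h
        using dt_integral_eq[OF ft in\<Omega>[OF that], of 0 s] s by auto
      show "continuous_on (ball 0 e \<times> cbox 0 s) (\<lambda>(h, r). p (x + h *\<^sub>R i) r)"
      proof -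
        have line: "continuous_on (ball 0 e \<times> cbox 0 s) (\<lambda>z. (x + fst z *\<^sub>R i, snd z))"
          by (intro continuous_intros)
        have sub: "(\<lambda>z. (x + fst z *\<^sub>R i, snd z)) ` (ball 0 e \<times> cbox 0 s) \<subseteq> \<Omega> \<times> {0..}"
          using in\<Omega> by auto
        show ?thesis
          using continuous_on_compose2[OF cont_up_continuous_on[OF p] line sub] by (simp add: case_prod_beta)
      qed
    qed (use e in auto)
    then have "((\<lambda>h. integral {0..s} (dt f (x + h *\<^sub>R i))) has_real_derivative
        integral {0..s} (p x)) (at 0)"
      using e by (simp add: at_within_open[of 0 "ball 0 e"])
    then have "((\<lambda>h. f (x + h *\<^sub>R i) 0 + integral {0..s} (dt f (x + h *\<^sub>R i))) has_real_derivative
        dx i f x 0 + integral {0..s} (p x)) (at 0)"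
      using has_cont_dx_DERIV[OF fx x _ i, of 0] by (intro DERIV_add) auto
    then have "((\<lambda>h. f (x + h *\<^sub>R i) s) has_real_derivative
        dx i f x 0 + integral {0..s} (p x)) (at 0)"
    proof (rule has_field_derivative_transform_within_open[of _ _ _ "ball 0 e"])
      show "f (x + h *\<^sub>R i) 0 + integral {0..s} (dt f (x + h *\<^sub>R i)) = f (x + h *\<^sub>R i) s"
        if "h \<in> ball 0 e" for h
        using integral_unique[OF dt_integral_eq[OF ft in\<Omega>[OF that] order_refl s]] by simp
    qed (use e in auto)
    then show ?thesis using has_cont_dx_DERIV[OF fx x s i] DERIV_unique by blast
  qed
  have "continuous_on {0..t+1} (p x)"
    using cont_up_continuous_on_time[OF p x] by (rule continuous_on_subset) auto
  then have "((\<lambda>s. dx i f x 0 + integral {0..s} (p x)) has_real_derivative p x t) (at t within {0..t+1})"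
    using integral_has_real_derivative[of 0 "t+1" "p x" t] t
    by (auto intro!: derivative_eq_intros)
  moreover have "at t within {0..t+1} = at t within {0..}"
    using at_within_Icc_eq_Ici[OF t] .
  ultimately have "((\<lambda>s. dx i f x 0 + integral {0..s} (p x)) has_real_derivative p x t) (at t within {0..})"
    by simp
  then show ?thesis
    unfolding p_def[symmetric]
    by (rule has_field_derivative_transform_within[of _ _ _ _ 1]) (use t in \<open>auto simp flip: inc\<close>)
qed

text \<open>The condition is placed on the continuous extension because Green's identity needs the
  limit from inside, while the smoothness assumptions describe \<open>dt f\<close> only at points of
  \<open>\<Omega>\<close>.\<close>

definition vanishes_on_boundary :: "'a::euclidean_space set \<Rightarrow> ('a \<Rightarrow> real \<Rightarrow> real) \<Rightarrow> bool" where
  "vanishes_on_boundary \<Omega> f \<longleftrightarrow>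
     (\<exists>g. continuous_on (closure \<Omega> \<times> {0..}) g \<and> (\<forall>x\<in>\<Omega>. \<forall>t\<ge>0. g (x, t) = f x t) \<and>
        (\<forall>x\<in>frontier \<Omega>. \<forall>t\<ge>0. g (x, t) = 0))"

text \<open>With \<open>G\<close> the extension of \<open>dt f\<close>, the relation between the
  time integral of \<open>G\<close> and the increment of \<open>F\<close> holds in
  \<open>\<Omega>\<close> and, both sides being continuous in \<open>x\<close>, on
  \<open>closure \<Omega>\<close>. At a frontier point the increment is zero for all times, so
  differentiating in \<open>t\<close> forces \<open>G\<close> to vanish there.\<close>

lemma vanishes_on_boundary_dt:
  fixes \<Omega> :: "'a::euclidean_space set"
  assumes "bounded \<Omega>" and f: "vanishes_on_boundary \<Omega> f" and ft: "has_cont_dt \<Omega> f"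
  shows "vanishes_on_boundary \<Omega> (dt f)"
proof -
  obtain F where F: "continuous_on (closure \<Omega> \<times> {0..}) F" "\<forall>x\<in>\<Omega>. \<forall>t\<ge>0. F (x, t) = f x t"
    "\<forall>x\<in>frontier \<Omega>. \<forall>t\<ge>0. F (x, t) = 0"
    using f unfolding vanishes_on_boundary_def by auto
  obtain G where G: "continuous_on (closure \<Omega> \<times> {0..}) G" "\<forall>x\<in>\<Omega>. \<forall>t\<ge>0. G (x, t) = dt f x t"
    using ft unfolding has_cont_dt_def cont_up_to_boundary_def by auto
  have FTC: "integral {0..t} (\<lambda>s. G (x, s)) = F (x, t) - F (x, 0)" if x: "x \<in> closure \<Omega>" and t: "0 \<le> t" for x t
  proof -
    have cG: "continuous_on (closure \<Omega>) (\<lambda>x. integral (cbox 0 t) (\<lambda>s. G (x, s)))"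
      by (rule integral_continuous_on_param)
        (auto intro!: continuous_on_subset[OF G(1)])
    have cF: "continuous_on (closure \<Omega>) (\<lambda>x. F (x, t) - F (x, 0))"
      using t by (intro continuous_intros continuous_on_compose2[OF F(1)]) auto
    have "integral {0..t} (\<lambda>s. G (x, s)) - (F (x, t) - F (x, 0)) = 0"
    proof (rule continuous_constant_on_closure[of \<Omega> "\<lambda>x. integral {0..t} (\<lambda>s. G (x, s)) - (F (x, t) - F (x, 0))"])
      show "continuous_on (closure \<Omega>) (\<lambda>x. integral {0..t} (\<lambda>s. G (x, s)) - (F (x, t) - F (x, 0)))"
        using continuous_on_diff[OF cG cF] by simp
      show "integral {0..t} (\<lambda>s. G (x, s)) - (F (x, t) - F (x, 0)) = 0" if "x \<in> \<Omega>" for x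
      proof -
        have "integral {0..t} (\<lambda>s. G (x, s)) = integral {0..t} (dt f x)"
          by (rule integral_cong) (use G that in auto)
        then show ?thesis
          using integral_unique[OF dt_integral_eq[OF ft that order_refl t]] F that t by auto
      qed
    qed (use x in auto)
    then show ?thesis by simp
  qed
  have "G (x, t) = 0" if x: "x \<in> frontier \<Omega>" and t: "0 \<le> t" for x t
  proof -
    have xc: "x \<in> closure \<Omega>" using x by (simp add: frontier_def)
    have "continuous_on {0..t+1} (\<lambda>s. G (x, s))"
      by (rule continuous_on_compose2[OF G(1)]) (use xc in \<open>auto intro!: continuous_intros\<close>)
    then have "((\<lambda>s. integral {0..s} (\<lambda>s. G (x, s))) has_real_derivative G (x, t)) (at t within {0..t+1})"
      by (rule integral_has_real_derivative) (use t in auto)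
    then have "((\<lambda>s. integral {0..s} (\<lambda>s. G (x, s))) has_real_derivative G (x, t)) (at t within {0..})"
      using at_within_Icc_eq_Ici[OF t] by simp
    then have "((\<lambda>s. 0) has_real_derivative G (x, t)) (at t within {0..})"
      by (rule has_field_derivative_transform_within[of _ _ _ _ 1])
        (use t F(3) FTC[OF xc] x in auto)
    then show ?thesis
      using has_real_derivative_unique_Ici[OF _ DERIV_const t] by blast
  qed
  then show ?thesis using G unfolding vanishes_on_boundary_def by blast
qed

section \<open>The logarithmic source\<close>

text \<open>Only \<open>s = 0\<close> is delicate. From \<open>ln y \<le> y - 1\<close> at
  \<open>y = 1 / \<bar>r\<bar>\<close> one gets
  \<open>\<bar>r\<bar> * \<bar>ln \<bar>r\<bar>\<bar> \<le> 1\<close> for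
  \<open>0 < \<bar>r\<bar> < 1\<close>; the remaining factor
  \<open>\<bar>r\<bar> powr (\<gamma> - 2)\<close> tends to zero because
  \<open>\<gamma> > 2\<close>.\<close>

lemma continuous_log_source:
  assumes "2 < \<gamma>"
  shows "continuous_on UNIV (log_source \<gamma>)"
proof -
  have "isCont (log_source \<gamma>) s" for s
  proof (cases "s = 0")
    case False
    then show ?thesis unfolding log_source_def by (auto intro!: continuous_intros)
  next
    case True
    have bound: "\<bar>log_source \<gamma> r\<bar> \<le> \<bar>r\<bar> powr (\<gamma> - 2)" if r: "r \<noteq> 0" "\<bar>r\<bar> < 1" for r
    proof -
      have "- ln \<bar>r\<bar> \<le> 1 / \<bar>r\<bar> - 1"
        using ln_le_minus_one[of "1 / \<bar>r\<bar>"] r by (simp add: ln_div)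
      then have "\<bar>r\<bar> * \<bar>ln \<bar>r\<bar>\<bar> \<le> 1"
        using r by (simp add: field_simps abs_of_neg)
      then show ?thesis
        using mult_left_mono[of "\<bar>r\<bar> * \<bar>ln \<bar>r\<bar>\<bar>" 1 "\<bar>r\<bar> powr (\<gamma> - 2)"]
        by (simp add: log_source_def abs_mult mult.assoc)
    qed
    have "((\<lambda>r::real. \<bar>r\<bar> powr (\<gamma> - 2)) \<longlongrightarrow> \<bar>0\<bar> powr (\<gamma> - 2)) (at 0)"
      using assms by (intro tendsto_powr' tendsto_intros) auto
    then have lim: "((\<lambda>r::real. \<bar>r\<bar> powr (\<gamma> - 2)) \<longlongrightarrow> 0) (at 0)"
      by simp
    have "((\<lambda>r. \<bar>log_source \<gamma> r\<bar>) \<longlongrightarrow> 0) (at 0)"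
    proof (rule tendsto_sandwich[OF _ _ tendsto_const lim])
      show "\<forall>\<^sub>F r in at 0. \<bar>log_source \<gamma> r\<bar> \<le> \<bar>r\<bar> powr (\<gamma> - 2)"
        unfolding eventually_at by (rule exI[of _ 1]) (use bound in auto)
    qed auto
    then have "(log_source \<gamma> \<longlongrightarrow> log_source \<gamma> 0) (at 0)"
      by (simp add: tendsto_rabs_zero_iff log_source_def[of _ 0])
    then show ?thesis using True by (simp add: isCont_def)
  qed
  then show ?thesis by (simp add: continuous_at_imp_continuous_on)
qed

lemma log_potential_has_derivative:
  assumes "2 < \<gamma>"
  shows "(log_potential \<gamma> has_real_derivative log_source \<gamma> s) (at s)"
proof -
  \<comment> \<open>The interval from \<open>a\<close> to \<open>c\<close> has both \<open>s\<close>
    and the lower limit \<open>0\<close> in its interior, whatever the sign of \<open>s\<close>;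
    hence the derivative obtained is two-sided.\<close>
  define a where "a = - \<bar>s\<bar> - 1"
  define c where "c = \<bar>s\<bar> + 1"
  have "((\<lambda>u. LBINT \<xi>=ereal 0..ereal u. log_source \<gamma> \<xi>) has_vector_derivative log_source \<gamma> s)
      (at s within {a..c})"
    by (rule interval_integral_FTC2)
      (auto simp: a_def c_def intro: continuous_on_subset[OF continuous_log_source[OF assms]])
  moreover have "at s within {a..c} = at s"
    by (rule at_within_interior) (auto simp: a_def c_def)
  ultimately show ?thesis
    by (simp add: log_potential_def[abs_def] has_real_derivative_iff_has_vector_derivative zero_ereal_def)
qed

lemma continuous_log_potential:
  assumes "2 < \<gamma>"
  shows "continuous_on UNIV (log_potential \<gamma>)"
  using log_potential_has_derivative[OF assms]
  by (meson DERIV_isCont continuous_at_imp_continuous_on)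

section \<open>Green's identity\<close>

lemma l2_norm_power2: "(l2_norm \<Omega> f)\<^sup>2 = (LINT x:\<Omega>|lborel. f x \<bullet> f x)"
proof -
  have "0 \<le> l2_inner \<Omega> f f"
    unfolding l2_inner_def set_lebesgue_integral_def
    by (intro Bochner_Integration.integral_nonneg) (auto simp: indicator_def)
  then show ?thesis by (simp add: l2_norm_def) (simp add: l2_inner_def)
qed

lemma grad_inner_grad:
  "grad (\<lambda>y. f y t) x \<bullet> grad (\<lambda>y. g y t) x = (\<Sum>i\<in>Basis. dx i f x t * dx i g x t)"
  by (subst euclidean_inner) (simp add: grad_def dx_def)

lemma laplacian_eq_dx: "laplacian (\<lambda>y. f y t) x = (\<Sum>i\<in>Basis. dx i (dx i f) x t)"
  by (simp add: laplacian_def dx_def)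

text \<open>The system imposes the boundary condition for \<open>t > 0\<close>; continuity in time
  carries it to \<open>t = 0\<close>.\<close>

lemma vanishes_on_boundaryI:
  fixes f :: "'a::euclidean_space \<Rightarrow> real \<Rightarrow> real"
  assumes cont: "continuous_on (closure \<Omega> \<times> {0..}) (\<lambda>(x, t). f x t)"
    and zero: "\<And>x t. x \<in> frontier \<Omega> \<Longrightarrow> 0 < t \<Longrightarrow> f x t = 0"
  shows "vanishes_on_boundary \<Omega> f"
proof -
  have "f x t = 0" if x: "x \<in> frontier \<Omega>" and t: "0 \<le> t" for x t
  proof (rule continuous_constant_on_closure[of "{0<..}" "f x"])
    have "continuous_on {0..} (\<lambda>t. (x, t))" by (intro continuous_intros)
    from continuous_on_compose2[OF cont this]
    show "continuous_on (closure {0<..}) (f x)" using x by (auto simp: frontier_def)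
  qed (use zero x t in auto)
  then show ?thesis
    using cont unfolding vanishes_on_boundary_def by (intro exI[of _ "\<lambda>(x, t). f x t"]) auto
qed

text \<open>The integrand is the divergence of \<open>f \<nabla>g\<close>, and its
  \<open>i\<close>-th summand is the \<open>i\<close>-th partial derivative of
  \<open>f * dx i g\<close>. The vanishing of \<open>f\<close> alone kills the boundary
  contribution, so \<open>g\<close> may have any normal derivative.\<close>

lemma green_identity:
  fixes \<Omega> :: "'a::euclidean_space set"
  assumes \<Omega>: "open \<Omega>" "bounded \<Omega>"
    and f: "vanishes_on_boundary \<Omega> f" and fx: "has_cont_dx \<Omega> f"
    and gx: "has_cont_dx \<Omega> g" and gxx: "has_cont_dxx \<Omega> g" and t: "0 \<le> t"
  shows "(LINT x:\<Omega>|lborel. (\<Sum>i\<in>Basis. dx i f x t * dx i g x t)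
            + f x t * (\<Sum>i\<in>Basis. dx i (dx i g) x t)) = 0"
proof -
  obtain F where F: "continuous_on (closure \<Omega> \<times> {0..}) F" "\<forall>x\<in>\<Omega>. \<forall>t\<ge>0. F (x, t) = f x t"
    "\<forall>x\<in>frontier \<Omega>. \<forall>t\<ge>0. F (x, t) = 0"
    using f unfolding vanishes_on_boundary_def by auto
  have slice: "continuous_on (closure \<Omega>) (\<lambda>x. H (x, t))"
    if "continuous_on (closure \<Omega> \<times> {0..}) H" for H :: "'a \<times> real \<Rightarrow> real"
    by (rule continuous_on_compose2[OF that]) (use t in \<open>auto intro!: continuous_intros\<close>)
  have cf: "cont_up_to_boundary \<Omega> f" using F unfolding cont_up_to_boundary_def by auto
  have cfx: "cont_up_to_boundary \<Omega> (dx i f)" "cont_up_to_boundary \<Omega> (dx i g)"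
    "cont_up_to_boundary \<Omega> (dx i (dx i g))" if "i \<in> Basis" for i
    using fx gx gxx that by (auto simp: has_cont_dx_def has_cont_dxx_def)
  have zero: "(LINT x:\<Omega>|lborel. dx i f x t * dx i g x t + f x t * dx i (dx i g) x t) = 0"
    if i: "i \<in> Basis" for i
  proof -
    \<comment> \<open>Integration by parts asks for continuity on \<open>closure \<Omega>\<close>,
      so the extensions \<open>A\<close>, \<open>B\<close>, \<open>C\<close> replace the
      derivatives. They agree with them in the open set \<open>\<Omega>\<close>, hence near
      \<open>h = 0\<close> on each line through a point of \<open>\<Omega>\<close>.\<close>
    obtain A where A: "continuous_on (closure \<Omega> \<times> {0..}) A" "\<forall>x\<in>\<Omega>. \<forall>t\<ge>0. A (x, t) = dx i f x t"
      using cfx(1)[OF i] unfolding cont_up_to_boundary_def by auto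
    obtain B where B: "continuous_on (closure \<Omega> \<times> {0..}) B" "\<forall>x\<in>\<Omega>. \<forall>t\<ge>0. B (x, t) = dx i g x t"
      using cfx(2)[OF i] unfolding cont_up_to_boundary_def by auto
    obtain C where C: "continuous_on (closure \<Omega> \<times> {0..}) C" "\<forall>x\<in>\<Omega>. \<forall>t\<ge>0. C (x, t) = dx i (dx i g) x t"
      using cfx(3)[OF i] unfolding cont_up_to_boundary_def by auto
    have "(LINT x:\<Omega>|lborel. A (x, t) * B (x, t) + F (x, t) * C (x, t)) = 0"
    proof (rule set_integral_partial_eq_0[OF \<Omega> i, of "\<lambda>x. F (x, t) * B (x, t)"])
      show "continuous_on (closure \<Omega>) (\<lambda>x. F (x, t) * B (x, t))"
        by (intro continuous_on_mult slice F B)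
      show "continuous_on (closure \<Omega>) (\<lambda>x. A (x, t) * B (x, t) + F (x, t) * C (x, t))"
        by (intro continuous_on_mult continuous_on_add slice F A B C)
      show "F (x, t) * B (x, t) = 0" if "x \<in> frontier \<Omega>" for x using F(3) that t by auto
      show "((\<lambda>h. F (x + h *\<^sub>R i, t) * B (x + h *\<^sub>R i, t)) has_real_derivative
          A (x, t) * B (x, t) + F (x, t) * C (x, t)) (at 0)" if x: "x \<in> \<Omega>" for x
      proof -
        define S where "S = (\<lambda>h. x + h *\<^sub>R i) -` \<Omega>"
        have "open S" unfolding S_def
          by (intro open_vimage \<Omega> continuous_intros)
        have "((\<lambda>h. f (x + h *\<^sub>R i) t * dx i g (x + h *\<^sub>R i) t) has_real_derivative
          A (x, t) * B (x, t) + F (x, t) * C (x, t)) (at 0)"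
          using DERIV_mult[OF has_cont_dx_DERIV[OF fx x t i] has_cont_dxx_DERIV[OF gxx x t i i]]
            A B C F x t by (simp add: algebra_simps)
        then show ?thesis
          by (rule has_field_derivative_transform_within_open[OF _ \<open>open S\<close>])
            (use F B t x in \<open>auto simp: S_def\<close>)
      qed
    qed
    moreover have "(LINT x:\<Omega>|lborel. A (x, t) * B (x, t) + F (x, t) * C (x, t))
        = (LINT x:\<Omega>|lborel. dx i f x t * dx i g x t + f x t * dx i (dx i g) x t)"
      by (rule set_lebesgue_integral_cong) (use \<Omega> A B C F t in auto)
    ultimately show ?thesis by simp
  qed
  have int: "set_integrable lborel \<Omega> (\<lambda>x. dx i f x t * dx i g x t + f x t * dx i (dx i g) x t)"
    if "i \<in> Basis" for i
    using cont_up_set_integrable[OF \<Omega> cont_up_add[OF cont_up_mult[OF cfx(1,2)] cont_up_mult[OF cf cfx(3)]] t]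
      that by auto
  have "(LINT x:\<Omega>|lborel. (\<Sum>i\<in>Basis. dx i f x t * dx i g x t)
            + f x t * (\<Sum>i\<in>Basis. dx i (dx i g) x t))
      = (LINT x:\<Omega>|lborel. (\<Sum>i\<in>Basis. dx i f x t * dx i g x t + f x t * dx i (dx i g) x t))"
    by (simp add: sum.distrib sum_distrib_left)
  also have "\<dots> = (\<Sum>i\<in>Basis. LINT x:\<Omega>|lborel. dx i f x t * dx i g x t + f x t * dx i (dx i g) x t)"
    unfolding set_lebesgue_integral_def scaleR_sum_right
    by (rule Bochner_Integration.integral_sum) (use int in \<open>simp add: set_integrable_def\<close>)
  finally show ?thesis using zero by simp
qed

lemma dt_eqI:
  assumes "(f x has_real_derivative D) (at t within {0..})" "0 \<le> t"
  shows "dt f x t = D"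
proof -
  have "f x differentiable (at t within {0..})"
    using assms by (auto simp: real_differentiable_def)
  then have "(f x has_real_derivative dt f x t) (at t within {0..})"
    unfolding dt_def has_real_derivative_iff_has_vector_derivative
    by (simp flip: vector_derivative_works)
  then show ?thesis using has_real_derivative_unique_Ici assms by blast
qed

text \<open>This carries the differential equations, imposed for \<open>t > 0\<close>, to
  \<open>t = 0\<close>, where the energy is to be differentiated as well.\<close>

lemma cont_up_eq_0:
  assumes "cont_up_to_boundary \<Omega> f" "x \<in> \<Omega>" "\<And>t. 0 < t \<Longrightarrow> f x t = 0" "0 \<le> t"
  shows "f x t = 0"
proof (rule continuous_constant_on_closure[of "{0<..}" "f x"])
  show "continuous_on (closure {0<..}) (f x)"
    using cont_up_continuous_on_time[OF assms(1,2)] by simp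
qed (use assms in auto)

section \<open>The energy identity\<close>

lemma energy_has_derivative:
  fixes \<Omega> :: "'a::euclidean_space set"
  assumes \<Omega>: "open \<Omega>" "bounded \<Omega>" and \<gamma>: "2 < \<gamma>"
    and su: "sufficiently_smooth_u \<Omega> u" and sv: "sufficiently_smooth_v \<Omega> v"
    and sol: "solves_system \<Omega> \<tau> b \<alpha> \<gamma> u v" and t: "0 \<le> t"
  shows "(energy \<Omega> \<tau> b \<alpha> \<gamma> u v has_real_derivative
            - (b - \<tau>) * (l2_norm \<Omega> (grad (\<lambda>x. dt v x t)))\<^sup>2) (at t within {0..})"
proof -
  let ?S = "\<lambda>f g x t. \<Sum>i\<in>(Basis::'a set). dx i f x t * dx i g x t"
  let ?L = "\<lambda>f x t. \<Sum>i\<in>(Basis::'a set). dx i (dx i f) x t"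
  have dts: "has_cont_dt \<Omega> u" "has_cont_dt \<Omega> (dt u)" "has_cont_dt \<Omega> v" "has_cont_dt \<Omega> (dt v)"
    "has_cont_dt \<Omega> (dt (dt v))"
    using su sv by (simp_all add: sufficiently_smooth_u_def sufficiently_smooth_v_def)
  have dxs: "has_cont_dx \<Omega> u" "has_cont_dx \<Omega> (dt u)" "has_cont_dx \<Omega> v" "has_cont_dx \<Omega> (dt v)"
    "has_cont_dx \<Omega> (dt (dt v))"
    using su sv by (simp_all add: sufficiently_smooth_u_def sufficiently_smooth_v_def)
  have dxxs: "has_cont_dxx \<Omega> u" "has_cont_dxx \<Omega> v" "has_cont_dxx \<Omega> (dt v)"
    using su sv by (simp_all add: sufficiently_smooth_u_def sufficiently_smooth_v_def)
  have van: "vanishes_on_boundary \<Omega> u" "vanishes_on_boundary \<Omega> v"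
    using su sv sol
    by (auto simp: sufficiently_smooth_u_def sufficiently_smooth_v_def solves_system_def
        intro!: vanishes_on_boundaryI)
  note van_t = vanishes_on_boundary_dt[OF \<Omega>(2) van(1) dts(1)]
    vanishes_on_boundary_dt[OF \<Omega>(2) van(2) dts(3)]
  note van_t = van_t vanishes_on_boundary_dt[OF \<Omega>(2) van_t(2) dts(4)]
  have c: "cont_up_to_boundary \<Omega> u" "cont_up_to_boundary \<Omega> (dt u)" "cont_up_to_boundary \<Omega> (dt (dt u))"
    "cont_up_to_boundary \<Omega> v" "cont_up_to_boundary \<Omega> (dt v)" "cont_up_to_boundary \<Omega> (dt (dt v))"
    "cont_up_to_boundary \<Omega> (dt (dt (dt v)))"
    using van dts by (auto simp: has_cont_dt_def vanishes_on_boundary_def cont_up_to_boundary_def)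
  have cx: "cont_up_to_boundary \<Omega> (dx i u)" "cont_up_to_boundary \<Omega> (dx i (dt u))"
    "cont_up_to_boundary \<Omega> (dx i v)" "cont_up_to_boundary \<Omega> (dx i (dt v))"
    "cont_up_to_boundary \<Omega> (dx i (dt (dt v)))" if "i \<in> Basis" for i
    using dxs that by (auto simp: has_cont_dx_def)
  have cxx: "cont_up_to_boundary \<Omega> (dx i (dx i u))" "cont_up_to_boundary \<Omega> (dx i (dx i v))"
    "cont_up_to_boundary \<Omega> (dx i (dx i (dt v)))" if "i \<in> Basis" for i
    using dxxs that by (auto simp: has_cont_dxx_def)
  have cls: "cont_up_to_boundary \<Omega> (\<lambda>x t. log_source \<gamma> (u x t))"
    "cont_up_to_boundary \<Omega> (\<lambda>x t. log_potential \<gamma> (u x t))"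
    using cont_up_compose c(1) continuous_log_source[OF \<gamma>] continuous_log_potential[OF \<gamma>] by blast+
  note cont_all = c cx cxx cls
  note D = has_cont_dt_DERIV[OF dts(1)] has_cont_dt_DERIV[OF dts(2)] has_cont_dt_DERIV[OF dts(3)]
    has_cont_dt_DERIV[OF dts(4)] has_cont_dt_DERIV[OF dts(5)]
  note Dx = dx_has_derivative_dt[OF \<Omega>(1) dts(1) dxs(1,2)] dx_has_derivative_dt[OF \<Omega>(1) dts(3) dxs(3,4)]
    dx_has_derivative_dt[OF \<Omega>(1) dts(4) dxs(4,5)]

  have eq_u: "dt (dt u) x t = ?L u x t - \<alpha> * (v x t + \<tau> * dt v x t) + log_source \<gamma> (u x t)"
    if x: "x \<in> \<Omega>" and t: "0 \<le> t" for x t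
  proof -
    have "dt (dt u) x t - ?L u x t + \<alpha> * (v x t + \<tau> * dt v x t) - log_source \<gamma> (u x t) = 0"
      by (rule cont_up_eq_0[where f = "\<lambda>x t. dt (dt u) x t - ?L u x t + \<alpha> * (v x t + \<tau> * dt v x t) - log_source \<gamma> (u x t)", OF _ x _ t])
        (use sol x in \<open>auto intro!: cont_up_intros cont_all simp: solves_system_def laplacian_eq_dx\<close>)
    then show ?thesis by simp
  qed
  have eq_v: "\<tau> * dt (dt (dt v)) x t = ?L v x t + b * ?L (dt v) x t - \<alpha> * u x t - dt (dt v) x t"
    if x: "x \<in> \<Omega>" and t: "0 \<le> t" for x t
  proof -
    have "\<tau> * dt (dt (dt v)) x t + dt (dt v) x t - ?L v x t - b * ?L (dt v) x t + \<alpha> * u x t = 0"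
      by (rule cont_up_eq_0[where f = "\<lambda>x t. \<tau> * dt (dt (dt v)) x t + dt (dt v) x t - ?L v x t - b * ?L (dt v) x t + \<alpha> * u x t", OF _ x _ t])
        (use sol x in \<open>auto intro!: cont_up_intros cont_all simp: solves_system_def laplacian_eq_dx\<close>)
    then show ?thesis by simp
  qed

  \<comment> \<open>Explicit combinations of derivatives of \<open>v\<close> stand for
    \<open>w\<close> and its derivatives. They equal \<open>dt w\<close> and \<open>dx i w\<close>
    at \<open>x\<close> in \<open>\<Omega>\<close> and \<open>t \<ge> 0\<close>, which suffices
    under the integral over \<open>\<Omega>\<close>.\<close>
  define w where "w x t = v x t + \<tau> * dt v x t" for x t
  define wt where "wt x t = dt v x t + \<tau> * dt (dt v) x t" for x t
  define wtt where "wtt x t = dt (dt v) x t + \<tau> * dt (dt (dt v)) x t" for x t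
  define wx where "wx i x t = dx i v x t + \<tau> * dx i (dt v) x t" for i x t
  define wtx where "wtx i x t = dx i (dt v) x t + \<tau> * dx i (dt (dt v)) x t" for i x t
  note w_defs = w_def[abs_def] wt_def[abs_def] wtt_def[abs_def] wx_def[abs_def] wtx_def[abs_def]
  have cw: "cont_up_to_boundary \<Omega> w" "cont_up_to_boundary \<Omega> wt" "cont_up_to_boundary \<Omega> wtt"
    unfolding w_defs by (intro cont_up_intros cont_all)+
  have cwx: "cont_up_to_boundary \<Omega> (wx i)" "cont_up_to_boundary \<Omega> (wtx i)" if "i \<in> Basis" for i
    unfolding w_defs by (intro cont_up_intros cont_all that)+
  have Dw: "(w x has_real_derivative wt x t) (at t within {0..})"
    "(wt x has_real_derivative wtt x t) (at t within {0..})" if "x \<in> \<Omega>" "0 \<le> t" for x t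
    unfolding w_defs using that by (auto intro!: DERIV_add DERIV_cmult D)
  have Dwx: "(wx i x has_real_derivative wtx i x t) (at t within {0..})"
    if "x \<in> \<Omega>" "0 \<le> t" "i \<in> Basis" for i x t
    unfolding w_defs using that by (auto intro!: DERIV_add DERIV_cmult Dx)
  have w_of: "w_of \<tau> v = w" by (simp add: w_of_def w_defs fun_eq_iff)
  have dt_w: "dt w x t = wt x t" if "x \<in> \<Omega>" "0 \<le> t" for x t
    by (rule dt_eqI[where f = w, OF Dw(1)[OF that] that(2)])
  have dx_w: "dx i w x t = wx i x t" if "x \<in> \<Omega>" "0 \<le> t" "i \<in> Basis" for i x t
  proof -
    have "((\<lambda>h. w (x + h *\<^sub>R i) t) has_real_derivative wx i x t) (at 0)"
      unfolding w_defs
      by (intro DERIV_add DERIV_cmult has_cont_dx_DERIV[OF dxs(3)] has_cont_dx_DERIV[OF dxs(4)] that)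
    then show ?thesis by (simp add: dx_def partial_def DERIV_imp_deriv)
  qed

  define e where "e x t = 1 / 2 * (dt u x t)\<^sup>2 + 1 / 2 * (wt x t)\<^sup>2
      + \<tau> * (b - \<tau>) / 2 * (\<Sum>i\<in>Basis. (dx i (dt v) x t)\<^sup>2) + 1 / 2 * (\<Sum>i\<in>Basis. (dx i u x t)\<^sup>2)
      + 1 / 2 * (\<Sum>i\<in>Basis. (wx i x t)\<^sup>2) + \<alpha> * (u x t * w x t) - log_potential \<gamma> (u x t)" for x t
  define e' where "e' x t = dt u x t * dt (dt u) x t + wt x t * wtt x t
      + \<tau> * (b - \<tau>) * ?S (dt v) (dt (dt v)) x t + ?S u (dt u) x t
      + (\<Sum>i\<in>Basis. wx i x t * wtx i x t) + \<alpha> * (dt u x t * w x t + u x t * wt x t)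
      - log_source \<gamma> (u x t) * dt u x t" for x t
  have De: "(e x has_real_derivative e' x t) (at t within {0..})" if x: "x \<in> \<Omega>" and t: "0 \<le> t" for x t
  proof -
    have sq: "((\<lambda>t. (f t)\<^sup>2) has_real_derivative 2 * (f t * f')) (at t within {0..})"
      if "(f has_real_derivative f') (at t within {0..})" for f f'
      using DERIV_power[OF that, of 2] by (simp add: mult.commute mult.left_commute)
    have ssq: "((\<lambda>t. \<Sum>i\<in>Basis. (f i t)\<^sup>2) has_real_derivative 2 * (\<Sum>i\<in>(Basis::'a set). f i t * f' i)) (at t within {0..})"
      if "\<And>i. i \<in> Basis \<Longrightarrow> (f i has_real_derivative f' i) (at t within {0..})" for f f'
      unfolding sum_distrib_left using that by (intro DERIV_sum sq) auto
    have pot: "((\<lambda>t. log_potential \<gamma> (u x t)) has_real_derivative log_source \<gamma> (u x t) * dt u x t) (at t within {0..})"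
      by (rule DERIV_chain2[OF log_potential_has_derivative[OF \<gamma>] D(1)[OF x t]])
    have "(e x has_real_derivative
        1 / 2 * (2 * (dt u x t * dt (dt u) x t)) + 1 / 2 * (2 * (wt x t * wtt x t))
      + \<tau> * (b - \<tau>) / 2 * (2 * ?S (dt v) (dt (dt v)) x t) + 1 / 2 * (2 * ?S u (dt u) x t)
      + 1 / 2 * (2 * (\<Sum>i\<in>Basis. wx i x t * wtx i x t)) + \<alpha> * (dt u x t * w x t + wt x t * u x t)
      - log_source \<gamma> (u x t) * dt u x t) (at t within {0..})"
      unfolding e_def[abs_def]
      by (intro DERIV_add DERIV_diff DERIV_cmult sq ssq pot DERIV_mult D Dw Dx Dwx x t)
    then show ?thesis by (simp add: e'_def mult.commute[of "wt x t" "u x t"] mult.assoc)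
  qed
  have ce: "cont_up_to_boundary \<Omega> e" "cont_up_to_boundary \<Omega> e'"
    unfolding e_def[abs_def] e'_def[abs_def] by (intro cont_up_intros cont_all cw cwx; assumption)+
  note int = cont_up_set_integrable[OF \<Omega>]
  have energy_eq: "energy \<Omega> \<tau> b \<alpha> \<gamma> u v t = (LINT x:\<Omega>|lborel. e x t)" if t: "0 \<le> t" for t
  proof -
    have i: "set_integrable lborel \<Omega> (\<lambda>x. (dt u x t)\<^sup>2)" "set_integrable lborel \<Omega> (\<lambda>x. (wt x t)\<^sup>2)"
      "set_integrable lborel \<Omega> (\<lambda>x. \<Sum>i\<in>Basis. (dx i (dt v) x t)\<^sup>2)"
      "set_integrable lborel \<Omega> (\<lambda>x. \<Sum>i\<in>Basis. (dx i u x t)\<^sup>2)"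
      "set_integrable lborel \<Omega> (\<lambda>x. \<Sum>i\<in>Basis. (wx i x t)\<^sup>2)"
      "set_integrable lborel \<Omega> (\<lambda>x. u x t * w x t)"
      "set_integrable lborel \<Omega> (\<lambda>x. log_potential \<gamma> (u x t))"
      by (intro int cont_up_intros cont_all cw cwx t; assumption)+
    have l2: "(l2_norm \<Omega> (\<lambda>x. dt u x t))\<^sup>2 = (LINT x:\<Omega>|lborel. (dt u x t)\<^sup>2)"
      "(l2_norm \<Omega> (\<lambda>x. dt w x t))\<^sup>2 = (LINT x:\<Omega>|lborel. (wt x t)\<^sup>2)"
      "(l2_norm \<Omega> (grad (\<lambda>x. dt v x t)))\<^sup>2 = (LINT x:\<Omega>|lborel. \<Sum>i\<in>Basis. (dx i (dt v) x t)\<^sup>2)"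
      "(l2_norm \<Omega> (grad (\<lambda>x. u x t)))\<^sup>2 = (LINT x:\<Omega>|lborel. \<Sum>i\<in>Basis. (dx i u x t)\<^sup>2)"
      "(l2_norm \<Omega> (grad (\<lambda>x. w x t)))\<^sup>2 = (LINT x:\<Omega>|lborel. \<Sum>i\<in>Basis. (wx i x t)\<^sup>2)"
      "l2_inner \<Omega> (\<lambda>x. u x t) (\<lambda>x. w x t) = (LINT x:\<Omega>|lborel. u x t * w x t)"
      unfolding l2_norm_power2 l2_inner_def grad_inner_grad
      by (rule set_lebesgue_integral_cong;
          use \<Omega> dt_w dx_w t in \<open>auto simp: power2_eq_square\<close>)+
    show ?thesis
      unfolding energy_def w_of l2 e_def using i by simp
  qed
  have "((\<lambda>t. LINT x:\<Omega>|lborel. e x t) has_real_derivative (LINT x:\<Omega>|lborel. e' x t)) (at t within {0..})"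
    by (rule has_real_derivative_set_integral[OF \<Omega> ce De t])
  \<comment> \<open>\<open>energy\<close> equals the integral of \<open>e\<close> for nonnegative
    times; for a derivative relative to \<open>{0..}\<close> this is enough.\<close>
  then have DE: "(energy \<Omega> \<tau> b \<alpha> \<gamma> u v has_real_derivative (LINT x:\<Omega>|lborel. e' x t)) (at t within {0..})"
    by (rule has_field_derivative_transform_within[of _ _ _ _ 1]) (use energy_eq t in auto)

  let ?G = "\<lambda>f g x. ?S f g x t + f x t * ?L g x t"
  have G0: "(LINT x:\<Omega>|lborel. ?G (dt u) u x) = 0" "(LINT x:\<Omega>|lborel. ?G (dt v) v x) = 0"
    "(LINT x:\<Omega>|lborel. ?G (dt v) (dt v) x) = 0" "(LINT x:\<Omega>|lborel. ?G (dt (dt v)) v x) = 0"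
    "(LINT x:\<Omega>|lborel. ?G (dt (dt v)) (dt v) x) = 0"
    by (intro green_identity \<Omega> van_t dxs dxxs t)+
  have Gi: "set_integrable lborel \<Omega> (?G (dt u) u)" "set_integrable lborel \<Omega> (?G (dt v) v)"
    "set_integrable lborel \<Omega> (?G (dt v) (dt v))" "set_integrable lborel \<Omega> (?G (dt (dt v)) v)"
    "set_integrable lborel \<Omega> (?G (dt (dt v)) (dt v))"
    by (intro int cont_up_intros cont_all t; assumption)+
  \<comment> \<open>The coupling terms cancel: \<open>\<alpha> u\<^sub>t w\<close> and
    \<open>\<alpha> u w\<^sub>t\<close> meet their negatives from the two equations, multiplied by
    \<open>u\<^sub>t\<close> and \<open>w\<^sub>t\<close>. The source meets the derivative of the
    potential. What is left pairs \<open>w\<^sub>t = v\<^sub>t + \<tau> v\<^sub>t\<^sub>t\<close>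
    with \<open>\<Delta>v + b\<Delta>v\<^sub>t\<close>, giving the four \<open>G\<close> terms in
    \<open>v\<close>.\<close>
  have pointwise: "e' x t = (?G (dt u) u x + ?G (dt v) v x + b * ?G (dt v) (dt v) x
      + \<tau> * ?G (dt (dt v)) v x + \<tau> * b * ?G (dt (dt v)) (dt v) x) - (b - \<tau>) * ?S (dt v) (dt v) x t"
    if x: "x \<in> \<Omega>" for x
  proof -
    have sym: "?S v (dt v) x t = ?S (dt v) v x t" "?S v (dt (dt v)) x t = ?S (dt (dt v)) v x t"
      "?S (dt v) (dt (dt v)) x t = ?S (dt (dt v)) (dt v) x t" "?S u (dt u) x t = ?S (dt u) u x t"
      by (simp_all add: mult.commute)
    have "(\<Sum>i\<in>Basis. wx i x t * wtx i x t) = ?S v (dt v) x t + \<tau> * ?S v (dt (dt v)) x t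
        + \<tau> * ?S (dt v) (dt v) x t + \<tau>\<^sup>2 * ?S (dt v) (dt (dt v)) x t"
      by (simp add: w_defs sum_distrib_left sum.distrib[symmetric] algebra_simps power2_eq_square)
    moreover have "wtt x t = ?L v x t + b * ?L (dt v) x t - \<alpha> * u x t"
      using eq_v[OF x t] by (simp add: wtt_def)
    ultimately show ?thesis
      unfolding e'_def eq_u[OF x t] w_def wt_def sym
      by (simp only: sym) (simp add: algebra_simps power2_eq_square)
  qed
  have "(LINT x:\<Omega>|lborel. e' x t)
      = (LINT x:\<Omega>|lborel. (?G (dt u) u x + ?G (dt v) v x + b * ?G (dt v) (dt v) x
      + \<tau> * ?G (dt (dt v)) v x + \<tau> * b * ?G (dt (dt v)) (dt v) x) - (b - \<tau>) * ?S (dt v) (dt v) x t)"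
    by (rule set_lebesgue_integral_cong) (use \<Omega> pointwise in auto)
  also have "\<dots> = (LINT x:\<Omega>|lborel. ?G (dt u) u x) + (LINT x:\<Omega>|lborel. ?G (dt v) v x)
      + b * (LINT x:\<Omega>|lborel. ?G (dt v) (dt v) x) + \<tau> * (LINT x:\<Omega>|lborel. ?G (dt (dt v)) v x)
      + \<tau> * b * (LINT x:\<Omega>|lborel. ?G (dt (dt v)) (dt v) x)
      - (b - \<tau>) * (LINT x:\<Omega>|lborel. ?S (dt v) (dt v) x t)"
  proof -
    have "set_integrable lborel \<Omega> (\<lambda>x. ?S (dt v) (dt v) x t)"
      by (intro int cont_up_intros cont_all t; assumption)
    then show ?thesis using Gi
      by (simp only: set_integral_add set_integral_diff set_integral_mult_right set_integrable_mult_right)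
  qed
  also have "\<dots> = - (b - \<tau>) * (l2_norm \<Omega> (grad (\<lambda>x. dt v x t)))\<^sup>2"
    unfolding G0 l2_norm_power2 grad_inner_grad by (simp add: algebra_simps)
  finally show ?thesis using DE by (simp only:)
qed

theorem proposition2p1:
  fixes \<Omega> :: "(real ^ 'n) set"
    and u v :: "real ^ 'n \<Rightarrow> real \<Rightarrow> real"
    and \<mu>\<^sub>1 b \<tau> \<alpha> \<gamma> :: real
  assumes "CARD('n) \<ge> 3"
    and "bounded_smooth_domain \<Omega>"
    and "first_dirichlet_eigenvalue \<Omega> \<mu>\<^sub>1"
    and "0 < \<tau>" and "\<tau> < b"
    and "\<bar>\<alpha>\<bar> < \<mu>\<^sub>1"
    and "2 < \<gamma>" and "\<gamma> < 2 * (real CARD('n) - 1) / (real CARD('n) - 2)"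
    and "sufficiently_smooth_u \<Omega> u" and "sufficiently_smooth_v \<Omega> v"
    and "solves_system \<Omega> \<tau> b \<alpha> \<gamma> u v"
  shows "(\<forall>t\<ge>0. energy \<Omega> \<tau> b \<alpha> \<gamma> u v t
            + (b - \<tau>) * (LBINT s=0..t. (l2_norm \<Omega> (grad (\<lambda>x. dt v x s)))\<^sup>2)
            = energy \<Omega> \<tau> b \<alpha> \<gamma> u v 0) \<and>
         (\<forall>t\<ge>0. (energy \<Omega> \<tau> b \<alpha> \<gamma> u v has_real_derivative
                    - (b - \<tau>) * (l2_norm \<Omega> (grad (\<lambda>x. dt v x t)))\<^sup>2) (at t within {0..}) \<and>
                - (b - \<tau>) * (l2_norm \<Omega> (grad (\<lambda>x. dt v x t)))\<^sup>2 \<le> 0)"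
proof -
  have \<Omega>: "open \<Omega>" "bounded \<Omega>" using assms(2) by (auto simp: bounded_smooth_domain_def)
  let ?E = "energy \<Omega> \<tau> b \<alpha> \<gamma> u v"
  define d where "d s = (l2_norm \<Omega> (grad (\<lambda>x. dt v x s)))\<^sup>2" for s
  have deriv: "(?E has_real_derivative - (b - \<tau>) * d t) (at t within {0..})" if "0 \<le> t" for t
    unfolding d_def by (rule energy_has_derivative) (use \<Omega> assms that in auto)
  \<comment> \<open>The integrated identity needs a continuous dissipation rate. It is even
    differentiable in time, by the same Leibniz rule, because
    \<open>\<nabla>v\<^sub>t\<^sub>t\<close> is continuous up to the boundary.\<close>
  have d_cont: "continuous_on {0..} d"
  proof -
    have sv: "has_cont_dt \<Omega> (dt v)" "has_cont_dx \<Omega> (dt v)" "has_cont_dx \<Omega> (dt (dt v))"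
      using assms(10) by (simp_all add: sufficiently_smooth_v_def)
    have cx: "cont_up_to_boundary \<Omega> (dx i (dt v))" "cont_up_to_boundary \<Omega> (dx i (dt (dt v)))"
      if "i \<in> Basis" for i
      using sv that by (auto simp: has_cont_dx_def)
    have "continuous_on {0..} (\<lambda>s. LINT x:\<Omega>|lborel. \<Sum>i\<in>Basis. dx i (dt v) x s * dx i (dt v) x s)"
    proof (rule DERIV_continuous_on, rule has_real_derivative_set_integral[OF \<Omega>])
      show "cont_up_to_boundary \<Omega> (\<lambda>x s. \<Sum>i\<in>Basis. dx i (dt v) x s * dx i (dt v) x s)"
        "cont_up_to_boundary \<Omega> (\<lambda>x s. \<Sum>i\<in>Basis. dx i (dt (dt v)) x s * dx i (dt v) x s
            + dx i (dt (dt v)) x s * dx i (dt v) x s)"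
        by (intro cont_up_intros cx; assumption)+
      show "((\<lambda>s. \<Sum>i\<in>Basis. dx i (dt v) x s * dx i (dt v) x s) has_real_derivative
          (\<Sum>i\<in>Basis. dx i (dt (dt v)) x t * dx i (dt v) x t + dx i (dt (dt v)) x t * dx i (dt v) x t))
          (at t within {0..})" if "x \<in> \<Omega>" "0 \<le> t" for x t
        by (intro DERIV_sum DERIV_mult dx_has_derivative_dt[OF \<Omega>(1) sv] that)
    qed auto
    then show ?thesis by (simp add: d_def[abs_def] l2_norm_power2 grad_inner_grad)
  qed
  have "?E t + (b - \<tau>) * (LBINT s=0..t. d s) = ?E 0" if t: "0 \<le> t" for t
  proof -
    have "(LBINT s=ereal 0..ereal t. - (b - \<tau>) * d s) = ?E t - ?E 0"
    proof (rule interval_integral_FTC_finite)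
      show "continuous_on {min 0 t..max 0 t} (\<lambda>s. - (b - \<tau>) * d s)"
        using t by (intro continuous_intros continuous_on_subset[OF d_cont]) auto
      show "(?E has_vector_derivative - (b - \<tau>) * d s) (at s within {min 0 t..max 0 t})"
        if "min 0 t \<le> s" "s \<le> max 0 t" for s
        using DERIV_subset[OF deriv, of s "{min 0 t..max 0 t}"] that t
        by (auto simp: has_real_derivative_iff_has_vector_derivative)
    qed
    then show ?thesis
      by (simp only: interval_lebesgue_integral_mult_right zero_ereal_def)
  qed
  moreover have "- (b - \<tau>) * d t \<le> 0" for t
    using assms(5) by (simp add: d_def mult_nonpos_nonneg)
  ultimately show ?thesis using deriv unfolding d_def by blast
qed

end
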